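(* Let $H$ be an infinite-dimensional separable complex Hilbert space, let $A\in L(H)$, let $\Omega\subset\mathbb C$ be open, let $r \in \mathbb N\cup\{0, \infty\}$, and let $d:\Omega\to\operatorname{Int} W_e(A)$ be a $C^r$-function. Then there exists a sequence $(u_n)_{n=1}^\infty \subset C^r (\Omega, H)$ such that (i) $\|u_n(\omega)\|=1$ for all $n\in\mathbb N$ and $\omega\in \Omega$; (ii) if $n\ne m$, then $u_m(\omega)\perp u_n(\omega')$ for all $\omega,\omega'\in \Omega$; (iii) $\langle Au_n(\omega),u_n(\omega)\rangle=d(\omega)$ for all $n\in\mathbb N$ and $\omega\in \Omega$; (iv) there exist a Hilbert space $X$ and a function $S \in C^r(\Omega, L(X, H))$ such that $S(\omega)$ is an isometry for every $\omega\in\Omega$ and \[ S^*(\omega) A S(\omega)=d(\omega) I, \qquad \omega \in \Omega. \]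
   Context: For $T\in L(H)$ the essential numerical range $W_e(T)$ is the set of all $\lambda\in\mathbb C$ for which there is an orthonormal sequence $(u_n)$ in $H$ with $\langle Tu_n,u_n\rangle\to\lambda$; $\operatorname{Int}$ denotes the interior in $\mathbb C$. Differentiability is understood in the real sense: $\Omega\subset\mathbb C$ is regarded as an open subset of $\mathbb R^2$, and $C^r(\Omega,X)$ (for a Banach space $X$, or $X=\mathbb C$) is the space of $r$ times continuously (real-)differentiable functions $\Omega\to X$, with $C^0$ meaning continuous and $C^\infty$ meaning infinitely differentiable. *)

theory Defs
  imports "HOL-Analysis.Analysis" "HOL-Library.Extended_Nat"
begin

text \<open>A complex Hilbert space is modelled as a real Hilbert space (real part of the
complex inner product) together with an orthogonal complex structure imul
(multiplication by the imaginary unit).\<close>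

class chilbert = real_inner + complete_space +
  fixes imul :: "'a \<Rightarrow> 'a"
  assumes imul_add: "imul (x + y) = imul x + imul y"
    and imul_scaleR: "imul (scaleR r x) = scaleR r (imul x)"
    and imul_imul: "imul (imul x) = - x"
    and inner_imul: "inner (imul x) (imul y) = inner x y"

definition scaleC :: "complex \<Rightarrow> 'a::chilbert \<Rightarrow> 'a"  (infixr "*\<^sub>C" 75) where
  "c *\<^sub>C x = Re c *\<^sub>R x + Im c *\<^sub>R imul x"

text \<open>Complex inner product, linear in the first argument, conjugate linear in the second.\<close>
definition cinner :: "'a::chilbert \<Rightarrow> 'a \<Rightarrow> complex" where
  "cinner x y = Complex (inner x y) (inner x (imul y))"

definition cspan :: "'a::chilbert set \<Rightarrow> 'a set" where
  "cspan B = span (B \<union> imul ` B)"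

definition infinite_dimensional :: "'a::chilbert itself \<Rightarrow> bool" where
  "infinite_dimensional _ \<longleftrightarrow> (\<forall>B::'a set. finite B \<longrightarrow> cspan B \<noteq> UNIV)"

definition csubspace :: "'a::chilbert set \<Rightarrow> bool" where
  "csubspace X \<longleftrightarrow> 0 \<in> X \<and> (\<forall>x\<in>X. \<forall>y\<in>X. x + y \<in> X) \<and> (\<forall>c. \<forall>x\<in>X. c *\<^sub>C x \<in> X)"

definition cblinop :: "('a::chilbert \<Rightarrow>\<^sub>L 'b::chilbert) \<Rightarrow> bool" where
  "cblinop T \<longleftrightarrow> (\<forall>x. blinfun_apply T (imul x) = imul (blinfun_apply T x))"

definition cadj :: "('a::chilbert \<Rightarrow>\<^sub>L 'b::chilbert) \<Rightarrow> ('b \<Rightarrow>\<^sub>L 'a)" where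
  "cadj T = (THE T'. cblinop T' \<and>
      (\<forall>x y. cinner (blinfun_apply T x) y = cinner x (blinfun_apply T' y)))"

definition orthonormal_seq :: "(nat \<Rightarrow> 'a::chilbert) \<Rightarrow> bool" where
  "orthonormal_seq u \<longleftrightarrow> (\<forall>n m. cinner (u n) (u m) = (if n = m then 1 else 0))"

definition ess_numrange :: "('a::chilbert \<Rightarrow>\<^sub>L 'a) \<Rightarrow> complex set" where
  "ess_numrange T = {c. \<exists>u. orthonormal_seq u \<and>
       (\<lambda>n. cinner (blinfun_apply T (u n)) (u n)) \<longlonglongrightarrow> c}"

definition pderiv_dir :: "complex \<Rightarrow> (complex \<Rightarrow> 'b::real_normed_vector) \<Rightarrow> complex \<Rightarrow> 'b" where
  "pderiv_dir v f z = frechet_derivative f (at z) v"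

text \<open>C^k: C^0 = continuous; C^(k+1) = (real) differentiable on the open set with both
partial derivatives of class C^k (equivalently, Frechet derivative of class C^k).\<close>
primrec Ck :: "nat \<Rightarrow> complex set \<Rightarrow> (complex \<Rightarrow> 'b::real_normed_vector) \<Rightarrow> bool" where
  "Ck 0 \<Omega> f \<longleftrightarrow> continuous_on \<Omega> f"
| "Ck (Suc k) \<Omega> f \<longleftrightarrow> (\<forall>z\<in>\<Omega>. f differentiable (at z)) \<and>
      Ck k \<Omega> (pderiv_dir 1 f) \<and> Ck k \<Omega> (pderiv_dir \<i> f)"

definition Cr :: "enat \<Rightarrow> complex set \<Rightarrow> (complex \<Rightarrow> 'b::real_normed_vector) \<Rightarrow> bool" where
  "Cr r \<Omega> f \<longleftrightarrow> (\<forall>k::nat. enat k \<le> r \<longrightarrow> Ck k \<Omega> f)"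

end

theory Submission
  imports Defs
begin

text \<open>
  Every finite subset of \<open>H\<close> has unit vectors \<open>x\<close> that are orthogonal to it, also with respect to the forms
  \<open>\<langle>Ax, y\<rangle>\<close> and \<open>\<langle>x, Ay\<rangle>\<close>, and whose value \<open>\<langle>Ax, x\<rangle>\<close> is as close as desired to a given point of the
  essential numerical range: correct an orthonormal sequence, which is weakly null, by vectors tending
  to \<open>0\<close>. For an interior point, three such vectors whose values span a triangle around it combine, with
  square roots of barycentric coordinates as coefficients, to a vector attaining it exactly.
  Hence for any \<open>\<mu>\<^sub>l\<close> in the interior there is an orthonormal family \<open>g l n\<close> that diagonalises the form
  \<open>\<langle>Ax, y\<rangle>\<close> with entries \<open>\<mu>\<^sub>l\<close>.

  Now choose \<open>\<mu>\<^sub>l\<close> and locally finite smooth real functions \<open>c l\<close> on the interior such that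
  \<open>\<Sum>l. (c l x)\<^sup>2 = 1\<close> and \<open>\<Sum>l. (c l x)\<^sup>2 \<mu>\<^sub>l = x\<close>: locally these are square roots of barycentric
  coordinates, glued by a partition of unity into squares. Then \<open>u\<^sub>n(\<omega>) = \<Sum>l. c l (d \<omega>) g l n\<close> and
  \<open>S(\<omega>) = \<Sum>l. c l (d \<omega>) W\<^sub>l\<close> work, where \<open>W\<^sub>l\<close> is the partial isometry taking \<open>f n = g 0 n\<close> to \<open>g l n\<close>;
  \<open>S\<close> is locally a finite sum of fixed operators, so its smoothness in the operator norm is that of
  the scalar coefficients, and \<open>X\<close> is the closed span of the \<open>f n\<close>.
\<close>

subsection \<open>Calculus of \<open>C\<^sup>k\<close> functions\<close>

lemma has_derivative_frechet:
  "f differentiable (at z) \<Longrightarrow> (f has_derivative frechet_derivative f (at z)) (at z)"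
  by (simp add: frechet_derivative_works)

lemma Ck_cong:
  assumes "open \<Omega>" "\<And>z. z \<in> \<Omega> \<Longrightarrow> f z = g z" "Ck k \<Omega> f"
  shows "Ck k \<Omega> g"
  using assms(2,3)
proof (induction k arbitrary: f g)
  case 0
  then show ?case by (auto cong: continuous_on_cong)
next
  case (Suc k)
  have der: "(g has_derivative frechet_derivative f (at z)) (at z)" if "z \<in> \<Omega>" for z
    using has_derivative_transform_within_open[OF has_derivative_frechet assms(1) that] Suc.prems that
    by auto
  then have "\<And>z. z \<in> \<Omega> \<Longrightarrow> pderiv_dir v f z = pderiv_dir v g z" for v
    by (metis frechet_derivative_at pderiv_dir_def)
  then have "Ck k \<Omega> (pderiv_dir 1 g)" "Ck k \<Omega> (pderiv_dir \<i> g)"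
    using Suc.IH Suc.prems(2) by (metis Ck.simps(2))+
  then show ?case
    using der by (auto simp: differentiable_def)
qed

lemma Ck_subset: "Ck k \<Omega> f \<Longrightarrow> U \<subseteq> \<Omega> \<Longrightarrow> Ck k U f"
  by (induction k arbitrary: f) (auto intro: continuous_on_subset)

lemma Ck_local:
  assumes "\<And>z. z \<in> \<Omega> \<Longrightarrow> \<exists>U. open U \<and> z \<in> U \<and> Ck k U f"
  shows "Ck k \<Omega> f"
  using assms
proof (induction k arbitrary: f)
  case 0
  then show ?case
    by (metis Ck.simps(1) continuous_at_imp_continuous_on continuous_on_eq_continuous_at)
next
  case (Suc k)
  show ?case
    unfolding Ck.simps
  proof (intro conjI ballI)
    fix z assume "z \<in> \<Omega>"
    then show "f differentiable (at z)" using Suc.prems by fastforce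
  next
    show "Ck k \<Omega> (pderiv_dir 1 f)" by (rule Suc.IH) (metis Suc.prems Ck.simps(2))
    show "Ck k \<Omega> (pderiv_dir \<i> f)" by (rule Suc.IH) (metis Suc.prems Ck.simps(2))
  qed
qed

lemma Ck_Suc_imp_Ck: "Ck (Suc k) \<Omega> f \<Longrightarrow> Ck k \<Omega> f"
proof (induction k arbitrary: f)
  case 0
  then show ?case
    by (auto intro!: continuous_at_imp_continuous_on differentiable_imp_continuous_within)
next
  case (Suc k)
  then show ?case by (metis Ck.simps(2))
qed

lemma Ck_imp_continuous_on: "Ck k \<Omega> f \<Longrightarrow> continuous_on \<Omega> f"
proof (induction k)
  case (Suc k)
  from Ck_Suc_imp_Ck[OF Suc.prems] show ?case by (rule Suc.IH)
qed simp

text \<open>Uniqueness of the derivative lets any explicit \<open>f'\<close> stand in for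
  \<open>frechet_derivative\<close>, so that the inductions below can use the ordinary
  differentiation rules.\<close>

lemma Ck_SucI:
  assumes "open \<Omega>" and der: "\<And>z. z \<in> \<Omega> \<Longrightarrow> (f has_derivative f' z) (at z)"
    and "Ck k \<Omega> (\<lambda>z. f' z 1)" "Ck k \<Omega> (\<lambda>z. f' z \<i>)"
  shows "Ck (Suc k) \<Omega> f"
proof -
  have "f' z v = pderiv_dir v f z" if "z \<in> \<Omega>" for z v
    by (metis der that frechet_derivative_at pderiv_dir_def)
  then have "Ck k \<Omega> (pderiv_dir 1 f)" "Ck k \<Omega> (pderiv_dir \<i> f)"
    using Ck_cong[OF assms(1) _ assms(3)] Ck_cong[OF assms(1) _ assms(4)] by blast+
  then show ?thesis
    using der by (auto simp: differentiable_def)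
qed

lemma Ck_SucD:
  assumes "Ck (Suc k) \<Omega> f"
  obtains f' where "\<And>z. z \<in> \<Omega> \<Longrightarrow> (f has_derivative f' z) (at z)"
    "Ck k \<Omega> (\<lambda>z. f' z 1)" "Ck k \<Omega> (\<lambda>z. f' z \<i>)"
  using that[of "\<lambda>z. frechet_derivative f (at z)"] assms
  by (auto simp: pderiv_dir_def[abs_def] frechet_derivative_works)

lemma Ck_const: "open \<Omega> \<Longrightarrow> Ck k \<Omega> (\<lambda>z. c)"
proof (induction k arbitrary: c)
  case (Suc k)
  then show ?case
    by (intro Ck_SucI[where f' = "\<lambda>z v. 0"]) auto
qed auto

lemma Ck_add:
  assumes "open \<Omega>" "Ck k \<Omega> f" "Ck k \<Omega> g"
  shows "Ck k \<Omega> (\<lambda>z. f z + g z)"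
  using assms(2,3)
proof (induction k arbitrary: f g)
  case (Suc k)
  obtain f' where f': "\<And>z. z \<in> \<Omega> \<Longrightarrow> (f has_derivative f' z) (at z)"
    "Ck k \<Omega> (\<lambda>z. f' z 1)" "Ck k \<Omega> (\<lambda>z. f' z \<i>)"
    using Suc.prems(1) by (rule Ck_SucD) blast
  obtain g' where g': "\<And>z. z \<in> \<Omega> \<Longrightarrow> (g has_derivative g' z) (at z)"
    "Ck k \<Omega> (\<lambda>z. g' z 1)" "Ck k \<Omega> (\<lambda>z. g' z \<i>)"
    using Suc.prems(2) by (rule Ck_SucD) blast
  show ?case
    by (rule Ck_SucI[OF assms(1), where f' = "\<lambda>z v. f' z v + g' z v"])
      (use f' g' Suc.IH in \<open>auto intro: has_derivative_add\<close>)
qed (auto intro: continuous_on_add)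

lemma Ck_sum:
  assumes "open \<Omega>" "\<And>i. i \<in> I \<Longrightarrow> Ck k \<Omega> (f i)"
  shows "Ck k \<Omega> (\<lambda>z. \<Sum>i\<in>I. f i z)"
  using assms(2)
  by (induction I rule: infinite_finite_induct) (auto intro: Ck_const Ck_add assms(1))

lemma (in bounded_linear) Ck_compose:
  assumes "open \<Omega>" "Ck k \<Omega> g"
  shows "Ck k \<Omega> (\<lambda>z. f (g z))"
  using assms(2)
proof (induction k arbitrary: g)
  case 0
  then show ?case by (auto intro: continuous_on)
next
  case (Suc k)
  obtain g' where g': "\<And>z. z \<in> \<Omega> \<Longrightarrow> (g has_derivative g' z) (at z)"
    "Ck k \<Omega> (\<lambda>z. g' z 1)" "Ck k \<Omega> (\<lambda>z. g' z \<i>)"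
    using Suc.prems by (rule Ck_SucD) blast
  show ?case
    by (rule Ck_SucI[OF assms(1), where f' = "\<lambda>z v. f (g' z v)"])
      (use g' Suc.IH in \<open>auto intro: has_derivative\<close>)
qed

lemma (in bounded_bilinear) Ck_prod:
  assumes "open \<Omega>" "Ck k \<Omega> f" "Ck k \<Omega> g"
  shows "Ck k \<Omega> (\<lambda>z. prod (f z) (g z))"
  using assms(2,3)
proof (induction k arbitrary: f g)
  case 0
  then show ?case by (auto intro: continuous_on)
next
  case (Suc k)
  obtain f' where f': "\<And>z. z \<in> \<Omega> \<Longrightarrow> (f has_derivative f' z) (at z)"
    "Ck k \<Omega> (\<lambda>z. f' z 1)" "Ck k \<Omega> (\<lambda>z. f' z \<i>)"
    using Suc.prems(1) by (rule Ck_SucD) blast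
  obtain g' where g': "\<And>z. z \<in> \<Omega> \<Longrightarrow> (g has_derivative g' z) (at z)"
    "Ck k \<Omega> (\<lambda>z. g' z 1)" "Ck k \<Omega> (\<lambda>z. g' z \<i>)"
    using Suc.prems(2) by (rule Ck_SucD) blast
  note fg = Suc.prems[THEN Ck_Suc_imp_Ck]
  show ?case
    by (rule Ck_SucI[OF assms(1), where f' = "\<lambda>z v. prod (f z) (g' z v) + prod (f' z v) (g z)"])
      (use f' g' fg Suc.IH in \<open>auto intro!: FDERIV Ck_add assms(1)\<close>)
qed

text \<open>Smoothness of the outer function is expressed by membership in a family closed under differentiation.\<close>

lemma Ck_compose_real:
  fixes \<F> :: "(real \<Rightarrow> real) set"
  assumes "open \<Omega>" "Ck k \<Omega> g" "g ` \<Omega> \<subseteq> T" "F \<in> \<F>"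
    and \<F>: "\<And>F. F \<in> \<F> \<Longrightarrow> \<exists>F'\<in>\<F>. \<forall>x\<in>T. (F has_real_derivative F' x) (at x)"
  shows "Ck k \<Omega> (\<lambda>z. F (g z))"
  using assms(2,4)
proof (induction k arbitrary: F)
  case 0
  obtain F' where "\<forall>x\<in>T. (F has_real_derivative F' x) (at x)"
    using \<F> 0 by blast
  then have "continuous_on T F"
    by (meson DERIV_continuous continuous_at_imp_continuous_on)
  then show ?case
    using 0 assms(3) by (auto intro: continuous_on_compose2)
next
  case (Suc k)
  obtain F' where F': "F' \<in> \<F>" "\<And>x. x \<in> T \<Longrightarrow> (F has_real_derivative F' x) (at x)"
    using \<F> Suc.prems(2) by blast
  obtain g' where g': "\<And>z. z \<in> \<Omega> \<Longrightarrow> (g has_derivative g' z) (at z)"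
    "Ck k \<Omega> (\<lambda>z. g' z 1)" "Ck k \<Omega> (\<lambda>z. g' z \<i>)"
    using Suc.prems(1) by (rule Ck_SucD) blast
  have "Ck k \<Omega> (\<lambda>z. F' (g z))"
    using Suc.IH[OF Ck_Suc_imp_Ck[OF Suc.prems(1)] F'(1)] .
  note mult = bounded_bilinear.Ck_prod[OF bounded_bilinear_mult assms(1) this]
  show ?case
  proof (rule Ck_SucI[OF assms(1), where f' = "\<lambda>z v. F' (g z) * g' z v"])
    fix z assume "z \<in> \<Omega>"
    then have "(F has_derivative (*) (F' (g z))) (at (g z))"
      using F'(2) assms(3) has_field_derivative_imp_has_derivative by blast
    from has_derivative_compose[OF g'(1) this] show "((\<lambda>z. F (g z)) has_derivative (\<lambda>v. F' (g z) * g' z v)) (at z)"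
      using \<open>z \<in> \<Omega>\<close> by simp
  qed (use mult g' in auto)
qed

subsection \<open>Smooth cutoffs and planar triangles\<close>

text \<open>The derivative of \<open>exp (-1/x)\<close> and its higher derivatives all have the form \<open>p (1/x) exp (-1/x)\<close>;
indexing by the polynomial \<open>p\<close> makes the family closed under differentiation.\<close>

definition flat :: "real poly \<Rightarrow> real \<Rightarrow> real" where
  "flat p x = (if x > 0 then poly p (1 / x) * exp (- (1 / x)) else 0)"

lemma poly_mult_exp_tendsto_0:
  "((\<lambda>y::real. poly p y * exp (- y)) \<longlongrightarrow> 0) at_top"
proof -
  \<comment> \<open>The factor \<open>y ^ k\<close> strengthens the induction:
    \<open>pCons a p\<close> splits off \<open>a\<close> and passes one more power of
    \<open>y\<close> to \<open>p\<close>.\<close>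
  have "((\<lambda>y::real. y ^ k * poly p y * exp (- y)) \<longlongrightarrow> 0) at_top" for k
  proof (induction p arbitrary: k)
    case (pCons a p)
    have "((\<lambda>y::real. a * (y ^ k / exp y) + y ^ Suc k * poly p y * exp (- y)) \<longlongrightarrow> a * 0 + 0) at_top"
      by (intro tendsto_intros tendsto_power_div_exp_0 pCons.IH)
    then show ?case by (simp add: algebra_simps exp_minus divide_inverse)
  qed simp
  from this[of 0] show ?thesis by simp
qed

text \<open>With y = 1/x, differentiating p(y) exp(-y) gives y^2 (p - p')(y) exp(-y); the two
  leading \<open>pCons 0\<close> supply y^2. At 0 the right difference quotient is y p(y) exp(-y)
  with y tending to infinity.\<close>

lemma flat_has_real_derivative:
  "(flat p has_real_derivative flat (pCons 0 (pCons 0 (p - pderiv p))) x) (at x)"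
proof -
  consider "x > 0" | "x < 0" | "x = 0" by linarith
  then show ?thesis
  proof cases
    case 1
    have "((\<lambda>x. poly p (1 / x) * exp (- (1 / x))) has_real_derivative
        flat (pCons 0 (pCons 0 (p - pderiv p))) x) (at x)"
      using 1 by (auto intro!: derivative_eq_intros DERIV_chain2[OF poly_DERIV]
          simp: flat_def field_simps power2_eq_square)
    then show ?thesis
      by (rule has_field_derivative_transform_within_open[of _ _ _ "{0<..}"])
        (use 1 in \<open>auto simp: flat_def\<close>)
  next
    case 2
    have "((\<lambda>x. 0) has_real_derivative flat (pCons 0 (pCons 0 (p - pderiv p))) x) (at x)"
      using 2 by (simp add: flat_def)
    then show ?thesis
      by (rule has_field_derivative_transform_within_open[of _ _ _ "{..<0}"])
        (use 2 in \<open>auto simp: flat_def\<close>)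
  next
    case 3
    have "((\<lambda>h. flat p h / h) \<longlongrightarrow> 0) (at_left 0)"
      by (rule tendsto_eventually) (auto simp: flat_def eventually_at_left_field intro: exI[of _ "-1"])
    moreover have "((\<lambda>h. flat p h / h) \<longlongrightarrow> 0) (at_right 0)"
    proof -
      have "((\<lambda>h. poly (pCons 0 p) (inverse h) * exp (- inverse h)) \<longlongrightarrow> 0) (at_right (0::real))"
        by (rule filterlim_compose[OF poly_mult_exp_tendsto_0 filterlim_inverse_at_top_right])
      then show ?thesis
        by (rule tendsto_cong[THEN iffD1, rotated])
          (auto simp: flat_def divide_inverse eventually_at_right_field intro: exI[of _ 1])
    qed
    ultimately have "((\<lambda>h. flat p h / h) \<longlongrightarrow> 0) (at 0)"
      by (simp add: filterlim_at_split)
    then show ?thesis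
      using 3 by (simp add: has_field_derivative_iff flat_def)
  qed
qed

lemma Ck_flat:
  assumes "open \<Omega>" "Ck k \<Omega> g"
  shows "Ck k \<Omega> (\<lambda>z. flat p (g z))"
  by (rule Ck_compose_real[OF assms, of UNIV _ "range flat"])
    (auto intro: flat_has_real_derivative)

lemma Ck_powr:
  fixes g :: "complex \<Rightarrow> real"
  assumes "open \<Omega>" "Ck k \<Omega> g" "\<And>z. z \<in> \<Omega> \<Longrightarrow> g z > 0"
  shows "Ck k \<Omega> (\<lambda>z. g z powr a)"
proof (rule Ck_compose_real[OF assms(1,2)])
  show "g ` \<Omega> \<subseteq> {0<..}" using assms(3) by auto
  show "(\<lambda>x. x powr a) \<in> {\<lambda>x. c * x powr b |b c. True}" by (rule CollectI, rule exI[of _ a], rule exI[of _ 1]) simp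
  fix F :: "real \<Rightarrow> real" assume "F \<in> {\<lambda>x. c * x powr b |b c. True}"
  then obtain b c where F: "F = (\<lambda>x. c * x powr b)" by auto
  show "\<exists>F'\<in>{\<lambda>x. c * x powr b |b c. True}. \<forall>x\<in>{0<..}. (F has_real_derivative F' x) (at x)"
    by (rule bexI[of _ "\<lambda>x. (c * b) * x powr (b - 1)"])
      (auto simp: F intro!: derivative_eq_intros)
qed

lemma Ck_sqrt:
  assumes "open \<Omega>" "Ck k \<Omega> g" "\<And>z. z \<in> \<Omega> \<Longrightarrow> g z > 0"
  shows "Ck k \<Omega> (\<lambda>z. sqrt (g z))"
  by (rule Ck_cong[OF assms(1) _ Ck_powr[OF assms, of "1/2"]])
    (auto simp: powr_half_sqrt less_imp_le assms(3))

text \<open>Smoothness of a real function in the form in which it is used. For products of flat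
  functions and powers it follows from the product rule, without formulas for higher
  derivatives.\<close>

definition Ck_stable :: "(real \<Rightarrow> real) \<Rightarrow> bool" where
  "Ck_stable f \<longleftrightarrow> (\<forall>k \<Omega> g. open \<Omega> \<longrightarrow> Ck k \<Omega> g \<longrightarrow> Ck k \<Omega> (\<lambda>z. f (g z)))"

text \<open>\<open>a\<close> is positive exactly for t < 1 and \<open>b\<close> exactly for t > 1/2,
  so \<open>D\<close> never vanishes; dividing both by the square root of \<open>D\<close> makes the
  squares sum to 1.\<close>

lemma smooth_cutoff_pair:
  obtains s c :: "real \<Rightarrow> real"
  where "\<And>t. (s t)\<^sup>2 + (c t)\<^sup>2 = 1" "\<And>t. t \<ge> 1 \<Longrightarrow> s t = 0" "\<And>t. t \<le> 1/2 \<Longrightarrow> c t = 0"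
    and "Ck_stable s" "Ck_stable c"
proof -
  define a where "a = (\<lambda>t. flat 1 (1 - t))"
  define b where "b = (\<lambda>t. flat 1 (t - 1/2))"
  define D where "D = (\<lambda>t. a t * a t + b t * b t)"
  have D: "D t > 0" for t
  proof (cases "t < 1")
    case True
    then have "a t > 0" by (simp add: a_def flat_def)
    then show ?thesis unfolding D_def by (intro add_pos_nonneg mult_pos_pos) auto
  next
    case False
    then have "b t > 0" by (simp add: b_def flat_def)
    then show ?thesis unfolding D_def by (intro add_nonneg_pos mult_pos_pos) auto
  qed
  note mult = bounded_bilinear.Ck_prod[OF bounded_bilinear_mult]
  have Ck: "Ck k \<Omega> (\<lambda>z. a (g z))" "Ck k \<Omega> (\<lambda>z. b (g z))" "Ck k \<Omega> (\<lambda>z. D (g z) powr (- (1/2)))"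
    if "open \<Omega>" "Ck k \<Omega> g" for k \<Omega> g
  proof -
    note neg = bounded_linear.Ck_compose[OF bounded_linear_minus[OF bounded_linear_ident] that]
    have "Ck k \<Omega> (\<lambda>z. flat 1 (1 + - g z))"
      by (rule Ck_flat[OF that(1) Ck_add[OF that(1) Ck_const[OF that(1)] neg]])
    then show a: "Ck k \<Omega> (\<lambda>z. a (g z))" by (simp add: a_def)
    have "Ck k \<Omega> (\<lambda>z. flat 1 (g z + - (1/2)))"
      by (rule Ck_flat[OF that(1) Ck_add[OF that Ck_const[OF that(1)]]])
    then show b: "Ck k \<Omega> (\<lambda>z. b (g z))" by (simp add: b_def)
    show "Ck k \<Omega> (\<lambda>z. D (g z) powr (- (1/2)))"
    proof (rule Ck_powr[OF that(1) _ D])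
      show "Ck k \<Omega> (\<lambda>z. D (g z))"
        unfolding D_def by (rule Ck_add[OF that(1) mult[OF that(1) a a] mult[OF that(1) b b]])
    qed
  qed
  have sq: "(x * D t powr (- (1/2)))\<^sup>2 = x * x / D t" for x t
  proof -
    have "(D t powr (- (1/2)))\<^sup>2 = D t powr (- (1/2) + - (1/2))"
      by (simp only: power2_eq_square powr_add)
    also have "- (1/2) + - (1/2) = (- 1 :: real)" by simp
    also have "D t powr (- 1) = 1 / D t"
      using D[of t] by (rule powr_neg_one)
    finally show ?thesis
      unfolding power_mult_distrib by (simp only: power2_eq_square times_divide_eq_right mult_1_right)
  qed
  show ?thesis
  proof (rule that[of "\<lambda>t. a t * D t powr (- (1/2))" "\<lambda>t. b t * D t powr (- (1/2))"])
    show "(a t * D t powr - (1 / 2))\<^sup>2 + (b t * D t powr - (1 / 2))\<^sup>2 = 1" for t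
      unfolding sq add_divide_distrib[symmetric] using D[of t]
      by (metis D_def divide_self less_irrefl)
    show "a t * D t powr - (1 / 2) = 0" if "t \<ge> 1" for t
      using that by (simp add: a_def flat_def)
    show "b t * D t powr - (1 / 2) = 0" if "t \<le> 1/2" for t
      using that by (simp add: b_def flat_def)
    show "Ck_stable (\<lambda>t. a t * D t powr - (1 / 2))"
      unfolding Ck_stable_def
    proof (intro allI impI)
      fix k \<Omega> and g :: "complex \<Rightarrow> real" assume *: "open \<Omega>" "Ck k \<Omega> g"
      show "Ck k \<Omega> (\<lambda>z. a (g z) * D (g z) powr - (1 / 2))"
        by (rule mult[OF *(1) Ck(1)[OF *] Ck(3)[OF *]])
    qed
    show "Ck_stable (\<lambda>t. b t * D t powr - (1 / 2))"
      unfolding Ck_stable_def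
    proof (intro allI impI)
      fix k \<Omega> and g :: "complex \<Rightarrow> real" assume *: "open \<Omega>" "Ck k \<Omega> g"
      show "Ck k \<Omega> (\<lambda>z. b (g z) * D (g z) powr - (1 / 2))"
        by (rule mult[OF *(1) Ck(2)[OF *] Ck(3)[OF *]])
    qed
  qed
qed

section \<open>Signed areas and triangles in the plane\<close>

definition cross :: "complex \<Rightarrow> complex \<Rightarrow> real" where
  "cross x y = Re x * Im y - Im x * Re y"

lemma abs_cross_le: "\<bar>cross x y\<bar> \<le> norm x * norm y"
proof -
  have "cross x y = Im (cnj x * y)" by (simp add: cross_def)
  then show ?thesis by (metis abs_Im_le_cmod norm_mult complex_mod_cnj)
qed

text \<open>The bilinear expansion of \<open>cross x' y'\<close> has three error terms, bounded by
  r^2/5, r^2/5 and r^2/100, in total less than r^2.\<close>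

lemma cross_perturb:
  assumes "norm x \<le> 2 * r" "norm y \<le> 2 * r" "norm (x' - x) \<le> r / 10" "norm (y' - y) \<le> r / 10"
    and "cross x y \<ge> r\<^sup>2" "r > 0"
  shows "cross x' y' > 0"
proof -
  have "cross x' y' = cross x y + cross x (y' - y) + cross (x' - x) y + cross (x' - x) (y' - y)"
    by (simp add: cross_def algebra_simps)
  moreover have "\<bar>cross x (y' - y)\<bar> \<le> 2 * r * (r / 10)" "\<bar>cross (x' - x) y\<bar> \<le> (r / 10) * (2 * r)"
      "\<bar>cross (x' - x) (y' - y)\<bar> \<le> (r / 10) * (r / 10)"
    using assms by (intro order.trans[OF abs_cross_le] mult_mono; simp)+
  moreover have "r * r > 0" using assms by simp
  ultimately show ?thesis using assms(5) unfolding power2_eq_square abs_le_iff by (simp add: algebra_simps)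
qed

text \<open>The hypothesis puts \<open>B\<close> inside the positively oriented triangle abc.
  Barycentric coordinates are quotients of signed areas with common denominator \<open>D\<close>,
  twice the area of abc. They are affine in \<open>l\<close>, and the form
  \<open>\<alpha> i + inner (\<beta> i) l\<close> makes their smoothness evident.\<close>

lemma barycentric_coordinates:
  assumes "\<And>l. l \<in> B \<Longrightarrow> cross (a - l) (b - l) > 0 \<and> cross (b - l) (c - l) > 0 \<and> cross (c - l) (a - l) > 0"
    and "B \<noteq> {}"
  shows "\<exists>(\<alpha> :: nat \<Rightarrow> real) (\<beta> :: nat \<Rightarrow> complex).
    (\<forall>i<3. \<forall>l\<in>B. \<alpha> i + inner (\<beta> i) l > 0) \<and>
    (\<forall>l. (\<Sum>i<3. \<alpha> i + inner (\<beta> i) l) = 1) \<and>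
    (\<forall>l. (\<Sum>i<3. of_real (\<alpha> i + inner (\<beta> i) l) * [a, b, c] ! i) = l)"
proof -
  define D where "D = cross a b + cross b c + cross c a"
  have D: "cross (a - l) (b - l) + cross (b - l) (c - l) + cross (c - l) (a - l) = D" for l
    by (simp add: D_def cross_def algebra_simps)
  have "D > 0" using assms D by (metis add_pos_pos all_not_in_conv)
  define \<alpha> where "\<alpha> = (\<lambda>i. [cross b c, cross c a, cross a b] ! i / D)"
  define \<beta> where "\<beta> = (\<lambda>i. (\<i> * [c - b, a - c, b - a] ! i) /\<^sub>R D)"
  \<comment> \<open>The term quadratic in \<open>l\<close> cancels, since
    \<open>cross l l = 0\<close>; multiplication by \<open>\<i>\<close> turns the linear part into
    an inner product.\<close>
  have cross_diff: "cross (x - l) (y - l) = cross x y + inner (\<i> * (y - x)) l" for x y l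
    by (simp add: cross_def inner_complex_def algebra_simps)
  have 0: "\<alpha> 0 + inner (\<beta> 0) l = cross (b - l) (c - l) / D"
    and 1: "\<alpha> 1 + inner (\<beta> 1) l = cross (c - l) (a - l) / D"
    and 2: "\<alpha> 2 + inner (\<beta> 2) l = cross (a - l) (b - l) / D" for l
    unfolding cross_diff by (simp_all add: \<alpha>_def \<beta>_def divide_inverse algebra_simps)
  have sum3: "(\<Sum>i<3. f i) = f 0 + f 1 + f 2" for f :: "nat \<Rightarrow> 'z::comm_monoid_add"
    by (simp add: numeral_3_eq_3 numeral_2_eq_2 add.assoc)
  show ?thesis
  proof (intro exI conjI allI impI ballI)
    show "\<alpha> i + inner (\<beta> i) l > 0" if "i < 3" "l \<in> B" for i l
    proof -
      have "i = 0 \<or> i = 1 \<or> i = 2" using that(1) by auto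
      then show ?thesis using assms(1)[OF that(2)] \<open>D > 0\<close> 0 1 2 by auto
    qed
    show "(\<Sum>i<3. \<alpha> i + inner (\<beta> i) l) = 1" for l
      unfolding sum3 0 1 2 add_divide_distrib[symmetric] using D[of l] \<open>D > 0\<close> by (simp add: algebra_simps)
    have "of_real (cross (b - l) (c - l)) * a + of_real (cross (c - l) (a - l)) * b +
        of_real (cross (a - l) (b - l)) * c = of_real D * l" for l
      by (simp add: D_def cross_def complex_eq_iff algebra_simps)
    then show "(\<Sum>i<3. of_real (\<alpha> i + inner (\<beta> i) l) * [a, b, c] ! i) = l" for l
      unfolding sum3 0 1 2 using \<open>D > 0\<close> by (simp add: field_simps)
  qed
qed

text \<open>The slack in the vertices serves for numerical range values that are attained only
  approximately, the slack in the point for coordinates valid on a whole ball around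
  \<open>p\<close>.\<close>

lemma stable_triangle:
  assumes "open G" "p \<in> G"
  obtains \<delta> a b c where "\<delta> > 0" "a \<in> G" "b \<in> G" "c \<in> G"
    and "\<And>a' b' c' l. dist a' a < \<delta> \<Longrightarrow> dist b' b < \<delta> \<Longrightarrow> dist c' c < \<delta> \<Longrightarrow> dist p l < 2 * \<delta> \<Longrightarrow>
      cross (a' - l) (b' - l) > 0 \<and> cross (b' - l) (c' - l) > 0 \<and> cross (c' - l) (a' - l) > 0"
proof -
  obtain e where e: "e > 0" "cball p e \<subseteq> G" using assms open_contains_cball by blast
  define r where "r = e / 2"
  have r: "r > 0" using e r_def by simp
  \<comment> \<open>The unscaled vertices have norm at most 2 and cyclic \<open>cross\<close>
    products 1, 2, 1; the scale \<open>r = e / 2\<close> keeps the triangle in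
    \<open>cball p e\<close>.\<close>
  define x y z where "x = of_real r * Complex 1 0" and "y = of_real r * Complex (-1) 1"
    and "z = of_real r * Complex (-1) (-1)"
  have "norm (Complex (-1) 1) \<le> 2" "norm (Complex (-1) (-1)) \<le> 2"
    by (auto simp: cmod_def intro!: real_le_lsqrt)
  then have n: "norm x \<le> 2 * r" "norm y \<le> 2 * r" "norm z \<le> 2 * r"
    using r unfolding x_def y_def z_def norm_mult by (auto simp: cmod_def)
  have cr: "cross x y \<ge> r\<^sup>2" "cross y z \<ge> r\<^sup>2" "cross z x \<ge> r\<^sup>2"
    by (simp_all add: x_def y_def z_def cross_def power2_eq_square)
  \<comment> \<open>A moved vertex minus a moved point errs by less than \<delta> + 2 \<delta>; the
    tolerance r/10 of \<open>cross_perturb\<close> therefore dictates \<delta> = r/30.\<close>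
  have d: "norm ((a' - l) - w) \<le> r / 10" if "dist a' (p + w) < r / 30" "dist p l < 2 * (r / 30)" for a' w l
  proof -
    have eq: "(a' - l) - w = (a' - (p + w)) + (p - l)" by simp
    show ?thesis
      unfolding eq using that norm_triangle_ineq[of "a' - (p + w)" "p - l"] unfolding dist_norm by linarith
  qed
  show ?thesis
  proof (rule that[of "r / 30" "p + x" "p + y" "p + z"])
    show "p + x \<in> G" "p + y \<in> G" "p + z \<in> G"
      using n e(2) by (auto simp: r_def dist_norm subset_iff)
    fix a' b' c' l
    assume *: "dist a' (p + x) < r / 30" "dist b' (p + y) < r / 30" "dist c' (p + z) < r / 30" "dist p l < 2 * (r / 30)"
    show "cross (a' - l) (b' - l) > 0 \<and> cross (b' - l) (c' - l) > 0 \<and> cross (c' - l) (a' - l) > 0"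
      using cross_perturb[OF n(1,2) d[OF *(1,4)] d[OF *(2,4)] cr(1) r]
        cross_perturb[OF n(2,3) d[OF *(2,4)] d[OF *(3,4)] cr(2) r]
        cross_perturb[OF n(3,1) d[OF *(3,4)] d[OF *(1,4)] cr(3) r] by blast
  qed (use r in simp)
qed

section \<open>Gluing local barycentric coordinates\<close>

lemma sum_lessThan_mult:
  fixes f :: "nat \<Rightarrow> 'a::comm_monoid_add"
  shows "(\<Sum>l<n * k. f l) = (\<Sum>j<n. \<Sum>i<k. f (j * k + i))"
proof -
  have "sum f {j * k..<j * k + k} = (\<Sum>i<k. f (j * k + i))" for j
    by (subst sum.atLeastLessThan_shift_0) (simp add: atLeast0LessThan)
  then show ?thesis by (simp only: sum.nat_group[symmetric])
qed

text \<open>With P_j the product of the first j values of \<open>c\<close>, the j-th summand is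
  P_j^2 - P_(j+1)^2. The sum is 1 as soon as some \<open>c i\<close> with i < n vanishes.\<close>

lemma telescoping_weights:
  fixes s c :: "nat \<Rightarrow> real"
  assumes "\<And>j. (s j)\<^sup>2 + (c j)\<^sup>2 = 1"
  shows "(\<Sum>j<n. (s j * (\<Prod>i<j. c i))\<^sup>2) = 1 - (\<Prod>i<n. c i)\<^sup>2"
proof (induction n)
  case (Suc n)
  have sq: "(s n)\<^sup>2 = 1 - (c n)\<^sup>2" using assms[of n] by simp
  have "(\<Sum>j<Suc n. (s j * (\<Prod>i<j. c i))\<^sup>2) = 1 - (\<Prod>i<n. c i)\<^sup>2 + (s n * (\<Prod>i<n. c i))\<^sup>2"
    by (simp only: sum.lessThan_Suc Suc)
  also have "\<dots> = 1 - (\<Prod>i<Suc n. c i)\<^sup>2"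
    by (simp only: power_mult_distrib sq prod.lessThan_Suc) (simp add: algebra_simps)
  finally show ?case .
qed simp

text \<open>\<open>stable_triangle\<close> with unmoved vertices, as one closed formula so that the
  data can be chosen for all \<open>p\<close> at once.\<close>

lemma barycentric_patch:
  assumes "open G" "p \<in> G"
  shows "\<exists>\<delta> (\<alpha> :: nat \<Rightarrow> real) \<beta> m. \<delta> > 0 \<and> (\<forall>i<3. m i \<in> G) \<and>
    (\<forall>i<3. \<forall>l. dist p l < 2 * \<delta> \<longrightarrow> \<alpha> i + inner (\<beta> i) l > 0) \<and>
    (\<forall>l. (\<Sum>i<3. \<alpha> i + inner (\<beta> i) l) = 1) \<and>
    (\<forall>l. (\<Sum>i<3. of_real (\<alpha> i + inner (\<beta> i) l) * m i) = (l :: complex))"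
proof (rule stable_triangle[OF assms])
  fix \<delta> a b c assume \<delta>: "\<delta> > 0" "a \<in> G" "b \<in> G" "c \<in> G"
    and tri: "\<And>a' b' c' l. dist a' a < \<delta> \<Longrightarrow> dist b' b < \<delta> \<Longrightarrow> dist c' c < \<delta> \<Longrightarrow> dist p l < 2 * \<delta> \<Longrightarrow>
      cross (a' - l) (b' - l) > 0 \<and> cross (b' - l) (c' - l) > 0 \<and> cross (c' - l) (a' - l) > 0"
  have "\<exists>(\<alpha> :: nat \<Rightarrow> real) (\<beta> :: nat \<Rightarrow> complex).
    (\<forall>i<3. \<forall>l\<in>ball p (2 * \<delta>). \<alpha> i + inner (\<beta> i) l > 0) \<and>
    (\<forall>l. (\<Sum>i<3. \<alpha> i + inner (\<beta> i) l) = 1) \<and>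
    (\<forall>l. (\<Sum>i<3. of_real (\<alpha> i + inner (\<beta> i) l) * [a, b, c] ! i) = l)"
  proof (rule barycentric_coordinates)
    show "cross (a - l) (b - l) > 0 \<and> cross (b - l) (c - l) > 0 \<and> cross (c - l) (a - l) > 0"
      if "l \<in> ball p (2 * \<delta>)" for l
      using tri[of a b c l] \<delta>(1) that by simp
    show "ball p (2 * \<delta>) \<noteq> {}" using \<delta>(1) by simp
  qed
  moreover have "\<forall>i<3. [a, b, c] ! i \<in> G"
    using \<delta> by (simp add: less_Suc_eq numeral_3_eq_3)
  ultimately show ?thesis
    using \<delta>(1) unfolding mem_ball Ball_def by blast
qed

text \<open>An index \<open>l\<close> encodes a patch \<open>l div 3\<close> and a vertex
  \<open>l mod 3\<close> of its triangle. On each patch a point is a convex combination of the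
  vertices, and the squared weights \<open>\<theta> j\<close> average these representations. The
  coefficients enter the form quadratically, whence the square roots.\<close>

lemma smooth_convex_coefficients:
  fixes G :: "complex set"
  assumes "open G" "G \<noteq> {}"
  shows "\<exists>(c :: nat \<Rightarrow> complex \<Rightarrow> real) (\<mu> :: nat \<Rightarrow> complex).
    (\<forall>l. \<mu> l \<in> G) \<and>
    (\<forall>x\<in>G. \<exists>N U. open U \<and> x \<in> U \<and> (\<forall>y\<in>U. \<forall>l\<ge>N. c l y = 0)) \<and>
    (\<forall>x\<in>G. \<exists>N. (\<forall>l\<ge>N. c l x = 0) \<and> (\<Sum>l<N. (c l x)\<^sup>2) = 1 \<and>
      (\<Sum>l<N. of_real ((c l x)\<^sup>2) * \<mu> l) = x) \<and>
    (\<forall>k \<Omega> d l. open \<Omega> \<longrightarrow> Ck k \<Omega> d \<longrightarrow> d ` \<Omega> \<subseteq> G \<longrightarrow> Ck k \<Omega> (\<lambda>z. c l (d z)))"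
proof (rule smooth_cutoff_pair)
  fix s C :: "real \<Rightarrow> real"
  assume sC: "\<And>t. (s t)\<^sup>2 + (C t)\<^sup>2 = 1" "\<And>t. t \<ge> 1 \<Longrightarrow> s t = 0" "\<And>t. t \<le> 1/2 \<Longrightarrow> C t = 0"
    and "Ck_stable s" "Ck_stable C"
  then have Ck_s: "Ck k \<Omega> (\<lambda>z. s (g z))" and Ck_C: "Ck k \<Omega> (\<lambda>z. C (g z))"
    if "open \<Omega>" "Ck k \<Omega> g" for k \<Omega> g
    using that unfolding Ck_stable_def by blast+
  have "\<forall>p\<in>G. \<exists>\<delta> (\<alpha> :: nat \<Rightarrow> real) \<beta> m. \<delta> > 0 \<and> (\<forall>i<3. m i \<in> G) \<and>
    (\<forall>i<3. \<forall>l. dist p l < 2 * \<delta> \<longrightarrow> \<alpha> i + inner (\<beta> i) l > 0) \<and>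
    (\<forall>l. (\<Sum>i<3. \<alpha> i + inner (\<beta> i) l) = 1) \<and>
    (\<forall>l. (\<Sum>i<3. of_real (\<alpha> i + inner (\<beta> i) l) * m i) = l)"
    using barycentric_patch[OF assms(1)] by (rule ballI)
  then obtain \<delta> and \<alpha> :: "complex \<Rightarrow> nat \<Rightarrow> real" and \<beta> m where patch: "\<forall>p\<in>G. \<delta> p > 0 \<and> (\<forall>i<3. m p i \<in> G) \<and>
    (\<forall>i<3. \<forall>l. dist p l < 2 * \<delta> p \<longrightarrow> \<alpha> p i + inner (\<beta> p i) l > 0) \<and>
    (\<forall>l. (\<Sum>i<3. \<alpha> p i + inner (\<beta> p i) l) = 1) \<and>
    (\<forall>l. (\<Sum>i<3. of_real (\<alpha> p i + inner (\<beta> p i) l) * m p i) = l)"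
    unfolding bchoice_iff by (elim exE) (rule that; assumption)
  have \<delta>: "\<And>p. p \<in> G \<Longrightarrow> \<delta> p > 0"
    and m: "\<And>p i. p \<in> G \<Longrightarrow> i < 3 \<Longrightarrow> m p i \<in> G"
    and pos: "\<And>p i l. p \<in> G \<Longrightarrow> i < 3 \<Longrightarrow> dist p l < 2 * \<delta> p \<Longrightarrow> \<alpha> p i + inner (\<beta> p i) l > 0"
    and one: "\<And>p l. p \<in> G \<Longrightarrow> (\<Sum>i<3. \<alpha> p i + inner (\<beta> p i) l) = 1"
    and bary: "\<And>p l. p \<in> G \<Longrightarrow> (\<Sum>i<3. of_real (\<alpha> p i + inner (\<beta> p i) l) * m p i) = l"
    by (drule patch[THEN bspec], blast)+
  \<comment> \<open>Countably many patches can be put in order. That the balls of half radius cover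
    \<open>G\<close> leaves room for the cutoffs to decay before radius \<delta>.\<close>
  obtain \<F> where \<F>: "\<F> \<subseteq> (\<lambda>p. ball p (\<delta> p / 2)) ` G" "countable \<F>"
      "\<Union>\<F> = \<Union>((\<lambda>p. ball p (\<delta> p / 2)) ` G)"
    by (rule Lindelof[of "(\<lambda>p. ball p (\<delta> p / 2)) ` G"]) auto
  obtain P where P: "countable P" "P \<subseteq> G" "\<F> = (\<lambda>p. ball p (\<delta> p / 2)) ` P"
    using conjI[OF \<F>(2,1), unfolded countable_subset_image] by blast
  have cover: "G \<subseteq> (\<Union>p\<in>P. ball p (\<delta> p / 2))"
    using \<F>(3) P(3) \<delta> by (force simp: subset_iff)
  then have "P \<noteq> {}" using assms(2) by auto
  define q where "q = from_nat_into P"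
  have qG: "q j \<in> G" for j using P(2) from_nat_into[OF \<open>P \<noteq> {}\<close>] q_def by auto
  have qP: "\<exists>j. p = q j" if "p \<in> P" for p
    using from_nat_into_surj[OF P(1) that] q_def by auto
  \<comment> \<open>Unlike the distance itself, its square is smooth at the centre.\<close>
  define t where "t = (\<lambda>j x. inner (x - q j) (x - q j) * (1 / (\<delta> (q j))\<^sup>2))"
  have t: "t j x = (dist (q j) x / \<delta> (q j))\<^sup>2" for j x
    by (simp add: t_def dist_norm norm_minus_commute power2_norm_eq_inner power_divide)
  \<comment> \<open>Patch \<open>j\<close> receives its share of the mass left over by the patches
    before it. Repetitions in \<open>q\<close>, as for finite \<open>P\<close>, do no harm.\<close>
  define \<theta> where "\<theta> = (\<lambda>j x. s (t j x) * (\<Prod>i<j. C (t i x)))"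
  define b where "b = (\<lambda>j i x. \<alpha> (q j) i + inner (\<beta> (q j) i) x)"
  define c where "c = (\<lambda>l x. \<theta> (l div 3) x * sqrt (b (l div 3) (l mod 3) x))"
  have \<theta>0: "\<theta> j x = 0" if "\<delta> (q j) \<le> dist (q j) x" for j x
  proof -
    have "t j x \<ge> 1" unfolding t using that \<delta>[OF qG, of j] by simp
    then show ?thesis by (simp add: \<theta>_def sC)
  qed
  \<comment> \<open>On the half ball \<open>t j\<close> is at most 1/4, so \<open>C\<close> vanishes
    there and with it every later weight: this is local finiteness.\<close>
  have C0: "C (t j x) = 0" if "x \<in> ball (q j) (\<delta> (q j) / 2)" for j x
  proof -
    have "dist (q j) x / \<delta> (q j) \<le> 1/2" using that \<delta>[OF qG, of j] by (simp add: field_simps)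
    then have "t j x \<le> (1/2)\<^sup>2"
      unfolding t using \<delta>[OF qG, of j] by (intro power_mono) auto
    then show ?thesis by (intro sC) (simp add: power2_eq_square)
  qed
  have c0: "c l x = 0" if "x \<in> ball (q j) (\<delta> (q j) / 2)" "l \<ge> Suc j * 3" for l j x
  proof -
    have "j < l div 3" using that(2) by auto
    then have "(\<Prod>i<l div 3. C (t i x)) = 0" using C0[OF that(1)] by auto
    then show ?thesis by (simp add: c_def \<theta>_def)
  qed
  have in_ball: "\<exists>j. x \<in> ball (q j) (\<delta> (q j) / 2)" if "x \<in> G" for x
    using cover qP that by blast
  \<comment> \<open>The square of \<open>sqrt b\<close> is the absolute value of \<open>b\<close>,
    so positivity matters; where \<open>b\<close> may fail to be positive, \<open>\<theta> j\<close>
    vanishes.\<close>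
  have sq: "(c (j * 3 + i) x)\<^sup>2 = (\<theta> j x)\<^sup>2 * b j i x" if "i < 3" for j i x
  proof (cases "\<delta> (q j) \<le> dist (q j) x")
    case True
    then show ?thesis using that by (simp add: c_def \<theta>0)
  next
    case False
    then have "b j i x > 0"
      unfolding b_def using pos[OF qG that, of j x] \<delta>[OF qG, of j] by linarith
    then show ?thesis using that by (simp add: c_def power_mult_distrib)
  qed
  show ?thesis
  proof (rule exI[of _ c], rule exI[of _ "\<lambda>l. m (q (l div 3)) (l mod 3)"], intro conjI allI ballI impI)
    show "m (q (l div 3)) (l mod 3) \<in> G" for l using m[OF qG] by simp
    show "\<exists>N U. open U \<and> x \<in> U \<and> (\<forall>y\<in>U. \<forall>l\<ge>N. c l y = 0)" if "x \<in> G" for x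
      using in_ball[OF that] c0 open_ball by blast
    show "\<exists>N. (\<forall>l\<ge>N. c l x = 0) \<and> (\<Sum>l<N. (c l x)\<^sup>2) = 1 \<and>
            (\<Sum>l<N. of_real ((c l x)\<^sup>2) * m (q (l div 3)) (l mod 3)) = x" if x: "x \<in> G" for x
    proof -
      obtain j where j: "x \<in> ball (q j) (\<delta> (q j) / 2)" using in_ball[OF x] by blast
      have "(\<Prod>i<Suc j. C (t i x)) = 0" using C0[OF j] by auto
      then have \<theta>1: "(\<Sum>j<Suc j. (\<theta> j x)\<^sup>2) = 1"
        unfolding \<theta>_def by (subst telescoping_weights) (simp_all add: sC)
      have "(\<Sum>l<Suc j * 3. (c l x)\<^sup>2) = (\<Sum>j<Suc j. \<Sum>i<3. (\<theta> j x)\<^sup>2 * b j i x)"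
        unfolding sum_lessThan_mult by (intro sum.cong refl) (simp add: sq)
      also have "\<dots> = 1"
        using one[OF qG] \<theta>1 by (simp add: b_def flip: sum_distrib_left)
      finally have 1: "(\<Sum>l<Suc j * 3. (c l x)\<^sup>2) = 1" .
      have "(\<Sum>l<Suc j * 3. of_real ((c l x)\<^sup>2) * m (q (l div 3)) (l mod 3)) =
          (\<Sum>j<Suc j. \<Sum>i<3. of_real ((\<theta> j x)\<^sup>2) * (of_real (b j i x) * m (q j) i))"
        unfolding sum_lessThan_mult by (intro sum.cong refl) (simp add: sq)
      also have "\<dots> = (\<Sum>j<Suc j. of_real ((\<theta> j x)\<^sup>2) * x)"
        unfolding sum_distrib_left[symmetric] b_def bary[OF qG] ..
      also have "\<dots> = of_real (\<Sum>j<Suc j. (\<theta> j x)\<^sup>2) * x"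
        by (simp only: of_real_sum sum_distrib_right)
      also have "\<dots> = x"
        unfolding \<theta>1 by simp
      finally show ?thesis using 1 c0[OF j] by blast
    qed
    show "Ck k \<Omega> (\<lambda>z. c l (d z))" if \<Omega>: "open \<Omega>" "Ck k \<Omega> d" "d ` \<Omega> \<subseteq> G" for k \<Omega> d l
    proof -
      have diff: "Ck k \<Omega> (\<lambda>z. d z - a)" for a
        using Ck_add[OF \<Omega>(1,2) Ck_const[OF \<Omega>(1)], of "- a"] by simp
      have "Ck k \<Omega> (\<lambda>z. inner (d z - q j) (d z - q j) * (1 / (\<delta> (q j))\<^sup>2))" for j
        by (rule bounded_bilinear.Ck_prod[OF bounded_bilinear_mult \<Omega>(1)
            bounded_bilinear.Ck_prod[OF bounded_bilinear_inner \<Omega>(1) diff diff] Ck_const[OF \<Omega>(1)]])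
      then have Ck_t: "Ck k \<Omega> (\<lambda>z. t j (d z))" for j unfolding t_def .
      have "Ck k \<Omega> (\<lambda>z. \<Prod>i<j. C (t i (d z)))" for j
      proof (induction j)
        case (Suc j)
        show ?case
          unfolding prod.lessThan_Suc
          by (rule bounded_bilinear.Ck_prod[OF bounded_bilinear_mult \<Omega>(1) Suc Ck_C[OF \<Omega>(1) Ck_t]])
      qed (simp add: Ck_const \<Omega>(1))
      then have Ck_\<theta>: "Ck k \<Omega> (\<lambda>z. \<theta> j (d z))" for j
        unfolding \<theta>_def by (rule bounded_bilinear.Ck_prod[OF bounded_bilinear_mult \<Omega>(1) Ck_s[OF \<Omega>(1) Ck_t]])
      have "Ck k \<Omega> (\<lambda>z. inner a (d z))" for a
        by (rule bounded_linear.Ck_compose[OF bounded_linear_inner_right \<Omega>(1,2)])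
      then have Ck_b: "Ck k \<Omega> (\<lambda>z. b j i (d z))" for j i
        unfolding b_def by (rule Ck_add[OF \<Omega>(1) Ck_const[OF \<Omega>(1)]])
      define p where "p = q (l div 3)"
      \<comment> \<open>Two open sets cover \<Omega>: over the ball of radius 2 \<delta> the square
        root has a positive argument, and off the closed ball of radius \<delta> the coefficient is
        zero.\<close>
      have open1: "open (\<Omega> \<inter> d -` ball p (2 * \<delta> p))"
        by (rule continuous_open_preimage[OF Ck_imp_continuous_on[OF \<Omega>(2)] \<Omega>(1) open_ball])
      have open2: "open (\<Omega> \<inter> d -` (- cball p (\<delta> p)))"
        by (rule continuous_open_preimage[OF Ck_imp_continuous_on[OF \<Omega>(2)] \<Omega>(1)]) (simp add: open_Compl)
      have "Ck k (\<Omega> \<inter> d -` ball p (2 * \<delta> p)) (\<lambda>z. sqrt (b (l div 3) (l mod 3) (d z)))"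
      proof (rule Ck_sqrt[OF open1])
        show "Ck k (\<Omega> \<inter> d -` ball p (2 * \<delta> p)) (\<lambda>z. b (l div 3) (l mod 3) (d z))"
          by (rule Ck_subset[OF Ck_b Int_lower1])
      qed (use pos[OF qG] in \<open>auto simp: b_def p_def\<close>)
      then have 1: "Ck k (\<Omega> \<inter> d -` ball p (2 * \<delta> p)) (\<lambda>z. c l (d z))"
        unfolding c_def
        by (rule bounded_bilinear.Ck_prod[OF bounded_bilinear_mult open1 Ck_subset[OF Ck_\<theta> Int_lower1]])
      have 2: "Ck k (\<Omega> \<inter> d -` (- cball p (\<delta> p))) (\<lambda>z. c l (d z))"
      proof (rule Ck_cong[OF open2 _ Ck_const[OF open2]])
        show "0 = c l (d z)" if "z \<in> \<Omega> \<inter> d -` (- cball p (\<delta> p))" for z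
          using that \<theta>0[of "l div 3" "d z"] by (simp add: c_def p_def)
      qed
      have "z \<in> \<Omega> \<inter> d -` ball p (2 * \<delta> p) \<or> z \<in> \<Omega> \<inter> d -` (- cball p (\<delta> p))" if "z \<in> \<Omega>" for z
        using that \<delta>[OF qG, of "l div 3"] by (auto simp: p_def)
      then show ?thesis
        by (intro Ck_local) (metis 1 2 open1 open2)
    qed
  qed
qed

subsection \<open>Hilbert space preliminaries\<close>

instance chilbert \<subseteq> banach ..

lemma bounded_linear_imul: "bounded_linear (imul :: 'a::chilbert \<Rightarrow> 'a)"
proof
  show "\<exists>K. \<forall>x::'a. norm (imul x) \<le> norm x * K"
    by (intro exI[of _ 1]) (simp add: norm_eq_sqrt_inner inner_imul)
qed (simp_all add: imul_add imul_scaleR)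

lemma inner_imul_right: "inner x (imul y) = - inner (imul x) (y::'a::chilbert)"
  using inner_imul[of "imul x" y] by (simp add: imul_imul)

lemma norm_imul [simp]: "norm (imul x) = norm (x::'a::chilbert)"
  by (simp add: norm_eq_sqrt_inner inner_imul)

lemma inner_imul_self [simp]: "inner (imul x) (x::'a::chilbert) = 0"
  using inner_imul_right[of x x] by (simp add: inner_commute)

lemma bounded_bilinear_cinner: "bounded_bilinear (cinner :: 'a::chilbert \<Rightarrow> 'a \<Rightarrow> complex)"
proof
  show "\<exists>K. \<forall>x y::'a. norm (cinner x y) \<le> norm x * norm y * K"
  proof (intro exI[of _ 2] allI)
    fix x y :: 'a
    show "norm (cinner x y) \<le> norm x * norm y * 2"
      using cmod_le[of "cinner x y"] Cauchy_Schwarz_ineq2[of x y] Cauchy_Schwarz_ineq2[of x "imul y"]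
      by (simp add: cinner_def)
  qed
qed (simp_all add: cinner_def complex_eq_iff inner_add_left inner_add_right imul_add imul_scaleR)

interpretation cinner: bounded_bilinear "cinner :: 'a::chilbert \<Rightarrow> 'a \<Rightarrow> complex"
  by (rule bounded_bilinear_cinner)

lemma cinner_self: "cinner x x = of_real ((norm x)\<^sup>2)" for x :: "'a::chilbert"
  by (simp add: cinner_def complex_eq_iff power2_norm_eq_inner inner_imul_right)

lemma cinner_commute: "cinner y x = cnj (cinner x y)" for x y :: "'a::chilbert"
  by (simp add: cinner_def complex_eq_iff inner_imul_right[of y x] inner_commute[of y x] inner_commute[of "imul y" x])

lemma cinner_scaleC_left: "cinner (z *\<^sub>C x) y = z * cinner x y" for x y :: "'a::chilbert"
  by (simp add: cinner_def scaleC_def complex_eq_iff inner_add_left inner_diff_left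
      inner_imul_right imul_add imul_scaleR imul_imul)

lemma bounded_linear_scaleC: "bounded_linear (\<lambda>x::'a::chilbert. z *\<^sub>C x)"
  unfolding scaleC_def
  by (intro bounded_linear_add bounded_linear_scaleR_right
      bounded_linear_compose[OF bounded_linear_scaleR_right bounded_linear_imul])

section \<open>Bessel's inequality and weakly null sequences\<close>

lemma norm_sum_orthonormal:
  fixes u :: "'i \<Rightarrow> 'a::real_inner"
  assumes "\<And>n m. inner (u n) (u m) = (if n = m then 1 else 0)" "finite I"
  shows "(norm (\<Sum>n\<in>I. a n *\<^sub>R u n))\<^sup>2 = (\<Sum>n\<in>I. (a n)\<^sup>2)"
  unfolding power2_norm_eq_inner inner_sum_left inner_sum_right
  by (intro sum.cong refl) (simp add: assms power2_eq_square if_distrib cong: if_cong)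

text \<open>At the sum x of the \<open>\<phi> (u n) *\<^sub>R u n\<close>, the value of
  \<open>\<phi>\<close> and the squared norm are both the sum of squares, so the norm of x is at
  most \<open>K\<close>. Bounding functionals directly avoids the Riesz representation.\<close>

lemma bessel_functional:
  fixes u :: "nat \<Rightarrow> 'a::real_inner" and \<phi> :: "'a \<Rightarrow> real"
  assumes orth: "\<And>n m. inner (u n) (u m) = (if n = m then 1 else 0)"
    and "linear \<phi>" "\<And>x. \<phi> x \<le> K * norm x" "finite I"
  shows "(\<Sum>n\<in>I. (\<phi> (u n))\<^sup>2) \<le> K\<^sup>2"
proof -
  interpret linear \<phi> by fact
  define s where "s = (\<Sum>n\<in>I. (\<phi> (u n))\<^sup>2)"
  define x where "x = (\<Sum>n\<in>I. \<phi> (u n) *\<^sub>R u n)"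
  have "s \<ge> 0" by (simp add: s_def sum_nonneg)
  have "\<phi> x = s" by (simp add: x_def s_def sum scale power2_eq_square)
  moreover have nx: "(norm x)\<^sup>2 = s"
    unfolding x_def s_def by (rule norm_sum_orthonormal[OF orth \<open>finite I\<close>])
  ultimately have le: "norm x * norm x \<le> K * norm x" using assms(3)[of x] by (simp add: power2_eq_square)
  have "(norm x)\<^sup>2 \<le> K\<^sup>2"
  proof (cases "x = 0")
    case False
    then have "norm x \<le> K" using mult_right_le_imp_le[OF le] by simp
    then show ?thesis by (rule power_mono) simp
  qed simp
  then show ?thesis using nx by (simp add: s_def)
qed

lemma orthonormal_weakly_null:
  fixes u :: "nat \<Rightarrow> 'a::real_inner" and \<phi> :: "'a \<Rightarrow> real"
  assumes orth: "\<And>n m. inner (u n) (u m) = (if n = m then 1 else 0)"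
    and "bounded_linear \<phi>"
  shows "(\<lambda>n. \<phi> (u n)) \<longlonglongrightarrow> 0"
proof -
  obtain K where K: "\<And>x. norm (\<phi> x) \<le> norm x * K"
    using bounded_linear.bounded[OF assms(2)] by blast
  have "\<phi> x \<le> K * norm x" for x
    using K[of x] by (simp add: mult.commute abs_le_iff)
  then have "summable (\<lambda>n. (\<phi> (u n))\<^sup>2)"
    by (intro summableI_nonneg_bounded[of _ "K\<^sup>2"] bessel_functional[OF orth]
        bounded_linear.linear assms(2)) auto
  from summable_LIMSEQ_zero[OF this] have "(\<lambda>n. sqrt ((\<phi> (u n))\<^sup>2)) \<longlonglongrightarrow> sqrt 0"
    by (rule tendsto_real_sqrt)
  then show ?thesis by (simp add: tendsto_rabs_zero_iff)
qed

text \<open>Functionals are treated one at a time: if \<open>\<psi>\<close> does not vanish on the common kernel of the previous ones, a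
multiple of a fixed vector of that kernel removes the value of \<open>\<psi>\<close>. No representing vectors are needed.\<close>

lemma weakly_null_kernel_correction:
  fixes w :: "nat \<Rightarrow> 'a::real_normed_vector" and \<Phi> :: "('a \<Rightarrow> real) set"
  assumes "finite \<Phi>" "\<And>\<phi>. \<phi> \<in> \<Phi> \<Longrightarrow> bounded_linear \<phi>"
    and w: "\<And>\<phi> :: 'a \<Rightarrow> real. bounded_linear \<phi> \<Longrightarrow> (\<lambda>n. \<phi> (w n)) \<longlonglongrightarrow> 0"
  shows "\<exists>w'. (\<forall>n. \<forall>\<phi>\<in>\<Phi>. \<phi> (w' n) = 0) \<and> (\<lambda>n. w' n - w n) \<longlonglongrightarrow> 0"
  using assms(1,2)
proof (induction \<Phi>)
  case empty
  show ?case by (rule exI[of _ w]) simp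
next
  case (insert \<psi> \<Phi>)
  then obtain w' where w': "\<And>n \<phi>. \<phi> \<in> \<Phi> \<Longrightarrow> \<phi> (w' n) = 0" "(\<lambda>n. w' n - w n) \<longlonglongrightarrow> 0"
    by auto
  interpret \<psi>: bounded_linear \<psi> using insert.prems by simp
  show ?case
  proof (cases "\<forall>x. (\<forall>\<phi>\<in>\<Phi>. \<phi> x = 0) \<longrightarrow> \<psi> x = 0")
    case True
    then show ?thesis using w' by (intro exI[of _ w']) auto
  next
    case False
    then obtain x where x: "\<And>\<phi>. \<phi> \<in> \<Phi> \<Longrightarrow> \<phi> x = 0" "\<psi> x \<noteq> 0" by auto
    define w'' where "w'' = (\<lambda>n. w' n - (\<psi> (w' n) / \<psi> x) *\<^sub>R x)"
    have "(\<lambda>n. \<psi> (w n) + \<psi> (w' n - w n)) \<longlonglongrightarrow> 0 + \<psi> 0"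
      by (intro tendsto_add w \<psi>.tendsto w'(2) \<psi>.bounded_linear_axioms)
    then have "(\<lambda>n. \<psi> (w' n)) \<longlonglongrightarrow> 0" by (simp add: \<psi>.diff \<psi>.zero)
    then have "(\<lambda>n. (w' n - w n) - (\<psi> (w' n) / \<psi> x) *\<^sub>R x) \<longlonglongrightarrow> 0 - (0 / \<psi> x) *\<^sub>R x"
      by (intro tendsto_intros w'(2) x(2))
    moreover have "(\<lambda>n. (w' n - w n) - (\<psi> (w' n) / \<psi> x) *\<^sub>R x) = (\<lambda>n. w'' n - w n)"
      by (auto simp: w''_def)
    ultimately have "(\<lambda>n. w'' n - w n) \<longlonglongrightarrow> 0" by simp
    moreover have "\<phi> (w'' n) = 0" if "\<phi> \<in> insert \<psi> \<Phi>" for \<phi> n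
    proof -
      interpret \<phi>: bounded_linear \<phi> using insert.prems that by simp
      show ?thesis
        using that x(1)[of \<phi>] x(2) w'(1)[of \<phi> n] by (auto simp: w''_def \<phi>.diff \<phi>.scaleR)
    qed
    ultimately show ?thesis by blast
  qed
qed

section \<open>Unit vectors with a prescribed value of the form\<close>

lemma orthonormal_seq_inner:
  assumes "orthonormal_seq u"
  shows "inner (u n) (u m) = (if n = m then 1 else 0)" "inner (u n) (imul (u m)) = 0"
  using assms unfolding orthonormal_seq_def cinner_def
  by (auto simp: complex_eq_iff split: if_splits)

text \<open>With \<open>w n = u n + v n\<close>, every term of the expansion except
  \<open>B (u n) (u n)\<close> has a null factor \<open>v n\<close>, and \<open>u\<close> is
  bounded. It is used for the form of \<open>A\<close> and for the norm.\<close>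

lemma tendsto_bilinear_perturb:
  fixes B :: "'a::real_normed_vector \<Rightarrow> 'a \<Rightarrow> 'b::real_normed_vector"
  assumes "bounded_bilinear B" "\<And>n. norm (u n) = 1" "(\<lambda>n. w n - u n) \<longlonglongrightarrow> 0"
    and "(\<lambda>n. B (u n) (u n)) \<longlonglongrightarrow> c"
  shows "(\<lambda>n. B (w n) (w n)) \<longlonglongrightarrow> c"
proof -
  interpret bounded_bilinear B by fact
  define v where "v = (\<lambda>n. w n - u n)"
  have v: "v \<longlonglongrightarrow> 0" using assms(3) by (simp add: v_def)
  have u: "Bseq u" by (rule BseqI'[of _ 1]) (simp add: assms(2))
  have "Zfun (\<lambda>n. B (v n) (u n) + (B (u n) (v n) + B (v n) (v n))) sequentially"
    using v u unfolding tendsto_Zfun_iff diff_0_right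
    by (intro Zfun_add Zfun_left Zfun_prod_Bfun Bfun_prod_Zfun Zfun) auto
  then have "(\<lambda>n. B (v n) (u n) + (B (u n) (v n) + B (v n) (v n))) \<longlonglongrightarrow> 0"
    by (simp add: tendsto_Zfun_iff)
  from tendsto_add[OF this assms(4)] show ?thesis
    by (simp add: v_def diff_left diff_right)
qed

text \<open>An orthonormal sequence realising \<mu> is weakly null, so a null sequence moves it into
  the common kernel of finitely many functionals. The limit of the form is unchanged, and the norms
  still tend to 1, which permits normalisation.\<close>

lemma ess_numrange_approx:
  fixes A :: "'h::chilbert \<Rightarrow>\<^sub>L 'h"
  assumes "\<mu> \<in> ess_numrange A" "finite F" "e > 0"
  shows "\<exists>x. norm x = 1 \<and> dist (cinner (A x) x) \<mu> < e \<and>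
    (\<forall>y\<in>F. cinner x y = 0 \<and> cinner (A x) y = 0 \<and> cinner (A y) x = 0)"
proof -
  obtain u where u: "orthonormal_seq u" "(\<lambda>n. cinner (A (u n)) (u n)) \<longlonglongrightarrow> \<mu>"
    using assms(1) unfolding ess_numrange_def by blast
  note orth = orthonormal_seq_inner(1)[OF u(1)]
  have nu: "norm (u n) = 1" for n using orth[of n n] by (simp add: norm_eq_sqrt_inner)
  \<comment> \<open>The conditions as real functionals of \<open>x\<close>: \<open>imul\<close>
    supplies the imaginary parts, and \<open>cinner (A y) x\<close> is treated through its
    conjugate.\<close>
  define \<Phi> where "\<Phi> = (\<lambda>y x. inner x y) ` (F \<union> imul ` F \<union> A ` F \<union> imul ` A ` F) \<union>
    (\<lambda>y x. inner (A x) y) ` (F \<union> imul ` F)"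
  have "finite \<Phi>" using assms(2) by (simp add: \<Phi>_def)
  moreover have "bounded_linear \<phi>" if "\<phi> \<in> \<Phi>" for \<phi>
    using that unfolding \<Phi>_def
    by (auto intro: bounded_linear_inner_left bounded_linear_compose[OF bounded_linear_inner_left blinfun.bounded_linear_right])
  ultimately have "\<exists>w. (\<forall>n. \<forall>\<phi>\<in>\<Phi>. \<phi> (w n) = 0) \<and> (\<lambda>n. w n - u n) \<longlonglongrightarrow> 0"
    by (rule weakly_null_kernel_correction) (assumption | rule orthonormal_weakly_null[OF orth])+
  then obtain w where w: "\<And>n \<phi>. \<phi> \<in> \<Phi> \<Longrightarrow> \<phi> (w n) = 0" "(\<lambda>n. w n - u n) \<longlonglongrightarrow> 0"
    by blast
  have orth_w: "cinner (w n) y = 0 \<and> cinner (A (w n)) y = 0 \<and> cinner (A y) (w n) = 0" if "y \<in> F" for n y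
  proof -
    have \<Phi>: "(\<lambda>x. inner x y) \<in> \<Phi>" "(\<lambda>x. inner x (imul y)) \<in> \<Phi>" "(\<lambda>x. inner x (A y)) \<in> \<Phi>"
        "(\<lambda>x. inner x (imul (A y))) \<in> \<Phi>" "(\<lambda>x. inner (A x) y) \<in> \<Phi>" "(\<lambda>x. inner (A x) (imul y)) \<in> \<Phi>"
      using that unfolding \<Phi>_def by blast+
    have "cinner (w n) (A y) = 0" using \<Phi>(3,4)[THEN w(1)] by (simp add: cinner_def zero_complex.code)
    then have "cinner (A y) (w n) = 0" using cinner_commute[of "A y" "w n"] by simp
    then show ?thesis using \<Phi>[THEN w(1)] by (simp add: cinner_def zero_complex.code)
  qed
  have B: "bounded_bilinear (\<lambda>x y. cinner (A x) y)"
    by (rule bounded_bilinear.comp1[OF bounded_bilinear_cinner blinfun.bounded_linear_right])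
  have lim: "(\<lambda>n. cinner (A (w n)) (w n)) \<longlonglongrightarrow> \<mu>"
    by (rule tendsto_bilinear_perturb[OF B nu w(2) u(2)])
  have "(\<lambda>n. inner (w n) (w n)) \<longlonglongrightarrow> 1"
    by (rule tendsto_bilinear_perturb[OF bounded_bilinear_inner nu w(2)]) (simp add: orth)
  then have lim2: "(\<lambda>n. (norm (w n))\<^sup>2) \<longlonglongrightarrow> 1" by (simp add: power2_norm_eq_inner)
  have "(\<lambda>n. cinner (A (w n)) (w n) /\<^sub>R (norm (w n))\<^sup>2) \<longlonglongrightarrow> \<mu> /\<^sub>R 1"
    by (intro tendsto_intros lim lim2) simp
  then have "eventually (\<lambda>n. dist (cinner (A (w n)) (w n) /\<^sub>R (norm (w n))\<^sup>2) \<mu> < e) sequentially"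
    using assms(3) by (simp add: tendsto_iff)
  moreover have "eventually (\<lambda>n. (norm (w n))\<^sup>2 > 0) sequentially"
    using order_tendstoD(1)[OF lim2, of 0] by simp
  ultimately have "eventually (\<lambda>n. dist (cinner (A (w n)) (w n) /\<^sub>R (norm (w n))\<^sup>2) \<mu> < e \<and>
      (norm (w n))\<^sup>2 > 0) sequentially"
    by (rule eventually_conj)
  then obtain n where n: "dist (cinner (A (w n)) (w n) /\<^sub>R (norm (w n))\<^sup>2) \<mu> < e" "norm (w n) \<noteq> 0"
    using eventually_happens[of _ sequentially] by fastforce
  define x where "x = w n /\<^sub>R norm (w n)"
  have "cinner (A x) x = cinner (A (w n)) (w n) /\<^sub>R (norm (w n))\<^sup>2"
    by (simp add: x_def blinfun.scaleR_right cinner.scaleR_left cinner.scaleR_right power2_eq_square)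
  then have "dist (cinner (A x) x) \<mu> < e" using n(1) by simp
  moreover have "norm x = 1" using n(2) by (simp add: x_def)
  moreover have "\<forall>y\<in>F. cinner x y = 0 \<and> cinner (A x) y = 0 \<and> cinner (A y) x = 0"
    using orth_w[of _ n] by (simp add: x_def blinfun.scaleR_right cinner.scaleR_left cinner.scaleR_right)
  ultimately show ?thesis by blast
qed

lemma bilinear_diagonal3:
  assumes "bounded_bilinear B" "t1 \<ge> 0" "t2 \<ge> 0" "t3 \<ge> 0"
    and "B x1 x2 = 0" "B x2 x1 = 0" "B x1 x3 = 0" "B x3 x1 = 0" "B x2 x3 = 0" "B x3 x2 = 0"
    and "x = sqrt t1 *\<^sub>R x1 + sqrt t2 *\<^sub>R x2 + sqrt t3 *\<^sub>R x3"
  shows "B x x = t1 *\<^sub>R B x1 x1 + t2 *\<^sub>R B x2 x2 + t3 *\<^sub>R B x3 x3"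
proof -
  interpret bounded_bilinear B by fact
  show ?thesis
    using assms(2-10) by (simp add: assms(11) add_left add_right scaleR_left scaleR_right)
qed

text \<open>Three approximate vectors are picked in turn, each orthogonal to the earlier ones for
  the inner product and the form, so no cross terms arise. Their values move the vertices by less
  than \<delta>, hence still enclose \<mu>.\<close>

lemma exact_numrange_vector:
  fixes A :: "'h::chilbert \<Rightarrow>\<^sub>L 'h"
  assumes "\<mu> \<in> interior (ess_numrange A)" "finite F"
  shows "\<exists>x. norm x = 1 \<and> cinner (A x) x = \<mu> \<and>
    (\<forall>y\<in>F. cinner x y = 0 \<and> cinner (A x) y = 0 \<and> cinner (A y) x = 0)"
proof (rule stable_triangle[OF open_interior assms(1)])
  fix \<delta> a b c
  assume \<delta>: "\<delta> > 0" and abc: "a \<in> interior (ess_numrange A)" "b \<in> interior (ess_numrange A)" "c \<in> interior (ess_numrange A)"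
    and tri: "\<And>a' b' c' l. dist a' a < \<delta> \<Longrightarrow> dist b' b < \<delta> \<Longrightarrow> dist c' c < \<delta> \<Longrightarrow> dist \<mu> l < 2 * \<delta> \<Longrightarrow>
      cross (a' - l) (b' - l) > 0 \<and> cross (b' - l) (c' - l) > 0 \<and> cross (c' - l) (a' - l) > 0"
  note approx = ess_numrange_approx[OF subsetD[OF interior_subset] _ \<delta>]
  obtain x1 where x1: "norm x1 = 1" "dist (cinner (A x1) x1) a < \<delta>"
    "\<And>y. y \<in> F \<Longrightarrow> cinner x1 y = 0 \<and> cinner (A x1) y = 0 \<and> cinner (A y) x1 = 0"
    using approx[OF abc(1) assms(2)] by blast
  obtain x2 where x2: "norm x2 = 1" "dist (cinner (A x2) x2) b < \<delta>"
    "\<And>y. y \<in> insert x1 F \<Longrightarrow> cinner x2 y = 0 \<and> cinner (A x2) y = 0 \<and> cinner (A y) x2 = 0"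
    using approx[OF abc(2), of "insert x1 F"] assms(2) by blast
  obtain x3 where x3: "norm x3 = 1" "dist (cinner (A x3) x3) c < \<delta>"
    "\<And>y. y \<in> insert x2 (insert x1 F) \<Longrightarrow> cinner x3 y = 0 \<and> cinner (A x3) y = 0 \<and> cinner (A y) x3 = 0"
    using approx[OF abc(3), of "insert x2 (insert x1 F)"] assms(2) by blast
  define v where "v = [cinner (A x1) x1, cinner (A x2) x2, cinner (A x3) x3]"
  have "\<exists>(\<alpha> :: nat \<Rightarrow> real) (\<beta> :: nat \<Rightarrow> complex).
    (\<forall>i<3. \<forall>l\<in>{\<mu>}. \<alpha> i + inner (\<beta> i) l > 0) \<and>
    (\<forall>l. (\<Sum>i<3. \<alpha> i + inner (\<beta> i) l) = 1) \<and>
    (\<forall>l. (\<Sum>i<3. of_real (\<alpha> i + inner (\<beta> i) l) * v ! i) = l)"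
    unfolding v_def using tri[OF x1(2) x2(2) x3(2), of \<mu>] \<delta> by (intro barycentric_coordinates) auto
  then obtain \<alpha> :: "nat \<Rightarrow> real" and \<beta> where \<alpha>\<beta>: "\<forall>i<3. \<alpha> i + inner (\<beta> i) \<mu> > 0"
    "(\<Sum>i<3. \<alpha> i + inner (\<beta> i) \<mu>) = 1"
    "(\<Sum>i<3. of_real (\<alpha> i + inner (\<beta> i) \<mu>) * v ! i) = \<mu>"
    by auto
  define t where "t = (\<lambda>i. \<alpha> i + inner (\<beta> i) \<mu>)"
  have sum3: "(\<Sum>i<3. f i) = f 0 + f 1 + f 2" for f :: "nat \<Rightarrow> 'z::comm_monoid_add"
    by (simp add: numeral_3_eq_3 numeral_2_eq_2 add.assoc)
  have t: "t 0 > 0" "t 1 > 0" "t 2 > 0" "t 0 + t 1 + t 2 = 1"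
    and t\<mu>: "t 0 *\<^sub>R cinner (A x1) x1 + t 1 *\<^sub>R cinner (A x2) x2 + t 2 *\<^sub>R cinner (A x3) x3 = \<mu>"
    using \<alpha>\<beta> unfolding sum3 t_def[symmetric, THEN fun_cong] by (auto simp: t_def v_def scaleR_conv_of_real)
  define x where "x = sqrt (t 0) *\<^sub>R x1 + sqrt (t 1) *\<^sub>R x2 + sqrt (t 2) *\<^sub>R x3"
  have B: "bounded_bilinear (\<lambda>x y. cinner (A x) y)"
    by (rule bounded_bilinear.comp1[OF bounded_bilinear_cinner blinfun.bounded_linear_right])
  have "cinner (A x) x = t 0 *\<^sub>R cinner (A x1) x1 + t 1 *\<^sub>R cinner (A x2) x2 + t 2 *\<^sub>R cinner (A x3) x3"
    using t x2(3) x3(3) by (intro bilinear_diagonal3[OF B _ _ _ _ _ _ _ _ _ x_def]) auto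
  then have "cinner (A x) x = \<mu>" unfolding t\<mu> .
  moreover have "cinner x1 x2 = 0" "cinner x1 x3 = 0" "cinner x2 x3 = 0"
    using cinner_commute[of x1] cinner_commute[of x2 x3] x2(3) x3(3) by simp_all
  then have "cinner x x = t 0 *\<^sub>R cinner x1 x1 + t 1 *\<^sub>R cinner x2 x2 + t 2 *\<^sub>R cinner x3 x3"
    using x2(3) x3(3) t by (intro bilinear_diagonal3[OF bounded_bilinear_cinner _ _ _ _ _ _ _ _ _ x_def]) auto
  then have "of_real ((norm x)\<^sup>2) = (of_real (t 0 + t 1 + t 2) :: complex)"
    by (simp add: cinner_self x1(1) x2(1) x3(1) scaleR_conv_of_real)
  then have "norm x = 1"
    unfolding t(4) of_real_eq_iff using norm_ge_zero[of x] by (auto simp: power2_eq_1_iff)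
  moreover have "cinner x y = 0 \<and> cinner (A x) y = 0 \<and> cinner (A y) x = 0" if "y \<in> F" for y
    using that x1(3) x2(3) x3(3)
    by (simp add: x_def blinfun.add_right blinfun.scaleR_right cinner.add_left cinner.add_right
        cinner.scaleR_left cinner.scaleR_right)
  ultimately show ?thesis by blast
qed

lemma diagonalizing_sequence:
  fixes A :: "'h::chilbert \<Rightarrow>\<^sub>L 'h"
  assumes "\<And>n. \<mu> n \<in> interior (ess_numrange A)"
  shows "\<exists>g. orthonormal_seq g \<and> (\<forall>n m. cinner (A (g n)) (g m) = (if n = m then \<mu> n else 0))"
proof -
  define P where "P = (\<lambda>g n x. norm x = 1 \<and> cinner (A x) x = \<mu> n \<and>
    (\<forall>m<n. cinner x (g m) = 0 \<and> cinner (A x) (g m) = 0 \<and> cinner (A (g m)) x = 0))"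
  have "\<exists>g. \<forall>n. P g n (g n)"
  proof (rule dependent_wellorder_choice)
    show "P f n x = P g n x" if "\<And>m. m < n \<Longrightarrow> f m = g m" for x f g n
      using that by (simp add: P_def)
    show "\<exists>x. P g n x" for n g
      using exact_numrange_vector[OF assms, of "g ` {..<n}" n] by (auto simp: P_def)
  qed
  then obtain g where g: "\<And>n. P g n (g n)" by blast
  have "cinner (g n) (g m) = (if n = m then 1 else 0)" for n m
  proof (cases n m rule: linorder_cases)
    case less
    then show ?thesis using g[of m] cinner_commute[of "g n" "g m"] by (simp add: P_def)
  qed (use g[of n] in \<open>simp_all add: P_def cinner_self\<close>)
  moreover have "cinner (A (g n)) (g m) = (if n = m then \<mu> n else 0)" for n m
    using g[of n] g[of m] by (cases n m rule: linorder_cases) (auto simp: P_def)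
  ultimately show ?thesis unfolding orthonormal_seq_def by blast
qed

subsection \<open>Partial isometries between orthonormal sequences\<close>

text \<open>For orthonormal \<open>F\<close> and \<open>G\<close> this is the real partial isometry
  taking \<open>F n\<close> to \<open>G n\<close>; two copies make up the complex one.\<close>

definition transport :: "(nat \<Rightarrow> 'a::{real_inner,banach}) \<Rightarrow> (nat \<Rightarrow> 'a) \<Rightarrow> 'a \<Rightarrow> 'a" where
  "transport F G x = (\<Sum>n. inner x (F n) *\<^sub>R G n)"

text \<open>Finite pieces of the series have squared norm equal to the sum of the squared
  coefficients. Bessel's inequality therefore gives both the Cauchy criterion and the norm
  bound.\<close>

lemma
  fixes F G :: "nat \<Rightarrow> 'a::{real_inner,banach}"
  assumes F: "\<And>n m. inner (F n) (F m) = (if n = m then 1 else 0)"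
    and G: "\<And>n m. inner (G n) (G m) = (if n = m then 1 else 0)"
  shows transport_summable: "summable (\<lambda>n. inner x (F n) *\<^sub>R G n)" (is ?summable)
    and norm_transport_le: "norm (transport F G x) \<le> norm x" (is ?norm)
proof -
  have bessel: "(\<Sum>n\<in>I. (inner x (F n))\<^sup>2) \<le> (norm x)\<^sup>2" if "finite I" for I
    by (rule bessel_functional[OF F _ _ that])
      (auto intro: bounded_linear.linear bounded_linear_inner_right norm_cauchy_schwarz)
  have norm_sum: "(norm (\<Sum>n\<in>I. inner x (F n) *\<^sub>R G n))\<^sup>2 = (\<Sum>n\<in>I. (inner x (F n))\<^sup>2)"
    if "finite I" for I
    by (rule norm_sum_orthonormal[OF G that])
  have "summable (\<lambda>n. (inner x (F n))\<^sup>2)"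
    by (intro summableI_nonneg_bounded[of _ "(norm x)\<^sup>2"] bessel) auto
  note cauchy = this[unfolded summable_Cauchy, rule_format]
  show ?summable
    unfolding summable_Cauchy
  proof (intro allI impI)
    fix e :: real assume "e > 0"
    then obtain N where N: "\<And>m n. m \<ge> N \<Longrightarrow> norm (\<Sum>n\<in>{m..<n}. (inner x (F n))\<^sup>2) < e\<^sup>2"
      using cauchy[of "e\<^sup>2"] by auto
    have "norm (\<Sum>n\<in>{m..<n}. inner x (F n) *\<^sub>R G n) < e" if "m \<ge> N" for m n
    proof (rule power2_less_imp_less)
      show "(norm (\<Sum>n\<in>{m..<n}. inner x (F n) *\<^sub>R G n))\<^sup>2 < e\<^sup>2"
        unfolding norm_sum[OF finite_atLeastLessThan] using N[OF that, of n] by (simp add: abs_less_iff)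
    qed (use \<open>e > 0\<close> in simp)
    then show "\<exists>N. \<forall>m\<ge>N. \<forall>n. norm (\<Sum>n\<in>{m..<n}. inner x (F n) *\<^sub>R G n) < e" by blast
  qed
  then have "(\<lambda>N. norm (\<Sum>n<N. inner x (F n) *\<^sub>R G n)) \<longlonglongrightarrow> norm (transport F G x)"
    unfolding transport_def by (intro tendsto_norm summable_LIMSEQ)
  moreover have "norm (\<Sum>n<N. inner x (F n) *\<^sub>R G n) \<le> norm x" for N
    by (rule power2_le_imp_le) (simp_all only: norm_sum finite_lessThan bessel norm_ge_zero)
  ultimately show ?norm by (intro LIMSEQ_le_const2) auto
qed

locale orthonormal_pair =
  fixes F G :: "nat \<Rightarrow> 'a::{real_inner,banach}"
  assumes F: "\<And>n m. inner (F n) (F m) = (if n = m then 1 else 0)"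
    and G: "\<And>n m. inner (G n) (G m) = (if n = m then 1 else 0)"
begin

lemma bounded_linear_transport: "bounded_linear (transport F G)"
proof
  note s = transport_summable[OF F G]
  show "transport F G (x + y) = transport F G x + transport F G y" for x y
    unfolding transport_def suminf_add[OF s s] by (simp add: inner_add_left scaleR_add_left)
  show "transport F G (r *\<^sub>R x) = r *\<^sub>R transport F G x" for r x
    unfolding transport_def suminf_scaleR_right[OF s] by simp
  show "\<exists>K. \<forall>x. norm (transport F G x) \<le> norm x * K"
    using norm_transport_le[OF F G] by (intro exI[of _ 1]) simp
qed

lemma bounded_linear_transport_eq:
  assumes "bounded_linear B"
  shows "B (transport F G x) = (\<Sum>n. inner x (F n) *\<^sub>R B (G n))"
proof -
  interpret bounded_linear B by fact
  show ?thesis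
    unfolding transport_def suminf[OF transport_summable[OF F G]] by (simp add: scaleR)
qed

lemma inner_transport: "inner (transport F G x) y = inner x (transport G F y)"
proof -
  have "inner (transport F G x) y = (\<Sum>n. inner x (F n) * inner (G n) y)"
    using bounded_linear_transport_eq[OF bounded_linear_inner_left] by simp
  moreover have "inner x (transport G F y) = (\<Sum>n. inner y (G n) * inner x (F n))"
    using orthonormal_pair.bounded_linear_transport_eq[OF _ bounded_linear_inner_right, of G F]
    by (simp add: orthonormal_pair_def F G)
  ultimately show ?thesis by (simp add: inner_commute mult.commute)
qed

end

lemma transport_single:
  assumes "\<And>n. n \<noteq> m \<Longrightarrow> inner x (F n) = 0"
  shows "transport F G x = inner x (F m) *\<^sub>R G m"
proof -
  have "(\<lambda>n. inner x (F n) *\<^sub>R G n) = (\<lambda>n. if n = m then inner x (F m) *\<^sub>R G m else 0)"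
    using assms by auto
  then show ?thesis
    unfolding transport_def using sums_unique[OF sums_single[of m "\<lambda>_. inner x (F m) *\<^sub>R G m"]] by simp
qed

lemma orthonormal_pair_complex:
  assumes "orthonormal_seq f" "orthonormal_seq g"
  shows "orthonormal_pair f g" "orthonormal_pair (\<lambda>n. imul (f n)) (\<lambda>n. imul (g n))"
  using orthonormal_seq_inner[OF assms(1)] orthonormal_seq_inner[OF assms(2)]
  by unfold_locales (auto simp: inner_imul)

text \<open>The complex partial isometry \<open>x \<mapsto> \<Sum>n. \<langle>x, f n\<rangle> g n\<close>, split into real and imaginary coefficients.\<close>

definition ctransport :: "(nat \<Rightarrow> 'h::chilbert) \<Rightarrow> (nat \<Rightarrow> 'h) \<Rightarrow> 'h \<Rightarrow>\<^sub>L 'h" where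
  "ctransport f g = Blinfun (\<lambda>x. transport f g x + transport (\<lambda>n. imul (f n)) (\<lambda>n. imul (g n)) x)"

context
  fixes f g :: "nat \<Rightarrow> 'h::chilbert"
  assumes f: "orthonormal_seq f" and g: "orthonormal_seq g"
begin

interpretation re: orthonormal_pair f g
  by (rule orthonormal_pair_complex[OF f g])
interpretation im: orthonormal_pair "\<lambda>n. imul (f n)" "\<lambda>n. imul (g n)"
  by (rule orthonormal_pair_complex[OF f g])

lemma ctransport_apply:
  "ctransport f g x = transport f g x + transport (\<lambda>n. imul (f n)) (\<lambda>n. imul (g n)) x"
  unfolding ctransport_def
  by (rule bounded_linear_Blinfun_apply[THEN fun_cong])
    (intro bounded_linear_add re.bounded_linear_transport im.bounded_linear_transport)

lemma bounded_linear_ctransport_eq: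
  assumes "bounded_linear B"
  shows "B (ctransport f g x) = (\<Sum>n. inner x (f n) *\<^sub>R B (g n)) + (\<Sum>n. inner x (imul (f n)) *\<^sub>R B (imul (g n)))"
proof -
  interpret bounded_linear B by fact
  show ?thesis
    unfolding ctransport_apply add re.bounded_linear_transport_eq[OF assms] im.bounded_linear_transport_eq[OF assms] ..
qed

text \<open>Applying \<open>imul\<close> interchanges the two real series, because
  \<open>imul\<close> is skew for \<open>inner\<close>.\<close>

lemma cblinop_ctransport: "cblinop (ctransport f g)"
  unfolding cblinop_def
proof
  fix x
  have "imul (ctransport f g x) = (\<Sum>n. inner x (f n) *\<^sub>R imul (g n)) + (\<Sum>n. - (inner x (imul (f n)) *\<^sub>R g n))"
    using bounded_linear_ctransport_eq[OF bounded_linear_imul] by (simp add: imul_imul)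
  also have "(\<Sum>n. - (inner x (imul (f n)) *\<^sub>R g n)) = transport f g (imul x)"
    by (simp add: transport_def inner_imul_right)
  also have "(\<Sum>n. inner x (f n) *\<^sub>R imul (g n)) = transport (\<lambda>n. imul (f n)) (\<lambda>n. imul (g n)) (imul x)"
    by (simp add: transport_def inner_imul)
  finally show "ctransport f g (imul x) = imul (ctransport f g x)"
    by (simp add: ctransport_apply add.commute)
qed

text \<open>The hypothesis speaks of coefficients only, because the lemma is also applied to vectors
  such as \<open>A (g l n)\<close>, which may lie outside the closed span of the sequence.\<close>

lemma ctransport_single:
  assumes "\<And>m. cinner x (f m) = (if m = n then z else 0)"
  shows "ctransport f g x = z *\<^sub>C g n"
proof -
  have *: "inner x (f m) = (if m = n then Re z else 0)" "inner x (imul (f m)) = (if m = n then Im z else 0)" for m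
    using assms[of m] by (auto simp: cinner_def complex_eq_iff)
  show ?thesis
    using transport_single[of n x f g] transport_single[of n x "\<lambda>n. imul (f n)" "\<lambda>n. imul (g n)"]
    by (simp add: ctransport_apply scaleC_def *)
qed

end

lemma inner_ctransport:
  assumes "orthonormal_seq f" "orthonormal_seq g"
  shows "inner (ctransport f g x) y = inner x (ctransport g f y)"
  using orthonormal_pair.inner_transport[OF orthonormal_pair_complex(1)[OF assms]]
    orthonormal_pair.inner_transport[OF orthonormal_pair_complex(2)[OF assms]]
  by (simp add: ctransport_apply assms inner_add_left inner_add_right)

text \<open>The relation passes from \<open>g n\<close> to \<open>imul (g n)\<close> by complex
  linearity and then through the series. With \<open>g = f\<close> it extends identities from the
  \<open>f n\<close> to their closed span.\<close>

lemma eigen_on_range_ctransport: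
  assumes "orthonormal_seq f" "orthonormal_seq g" "cblinop B" "\<And>n. B (g n) = z *\<^sub>C g n"
  shows "B (ctransport f g x) = z *\<^sub>C ctransport f g x"
proof -
  have "B (imul (g n)) = z *\<^sub>C imul (g n)" for n
    using assms(3,4) unfolding cblinop_def by (simp add: scaleC_def imul_add imul_scaleR)
  then show ?thesis
    unfolding bounded_linear_ctransport_eq[OF assms(1,2) blinfun.bounded_linear_right]
      bounded_linear_ctransport_eq[OF assms(1,2) bounded_linear_scaleC] assms(4) by simp
qed

text \<open>Real adjointness suffices because \<open>T'\<close> commutes with \<open>imul\<close>;
  nondegeneracy of \<open>inner\<close> gives the uniqueness that \<open>THE\<close> in
  \<open>cadj\<close> requires.\<close>

lemma cadj_eqI:
  fixes T :: "'a::chilbert \<Rightarrow>\<^sub>L 'b::chilbert"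
  assumes "cblinop T'" "\<And>x y. inner (T x) y = inner x (T' y)"
  shows "cadj T = T'"
  unfolding cadj_def
proof (rule the_equality)
  have "cinner (T x) y = cinner x (T' y)" for x y
    using assms(1) by (simp add: cinner_def assms(2) cblinop_def)
  then show "cblinop T' \<and> (\<forall>x y. cinner (T x) y = cinner x (T' y))"
    using assms(1) by blast
  fix R assume R: "cblinop R \<and> (\<forall>x y. cinner (T x) y = cinner x (R y))"
  show "R = T'"
  proof (rule blinfun_eqI)
    fix y
    have "inner x (R y) = inner x (T' y)" for x
      using R assms(2)[of x y] unfolding cinner_def complex_eq_iff by (metis complex.sel(1))
    then show "R y = T' y" by (metis vector_eq_rdot inner_commute)
  qed
qed

text \<open>The cutoff in \<open>S\<close> may vary with the point; near each point one cutoff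
  serves throughout, and there \<open>S\<close> is a finite sum of smooth multiples of fixed
  vectors. For operators \<open>W l\<close> this is smoothness in the operator norm.\<close>

lemma Ck_locally_finite_sum:
  fixes c :: "nat \<Rightarrow> complex \<Rightarrow> real" and W :: "nat \<Rightarrow> 'b::real_normed_vector"
  assumes "open \<Omega>" "\<And>l. Ck k \<Omega> (c l)"
    and "\<And>z. z \<in> \<Omega> \<Longrightarrow> \<exists>N U. open U \<and> z \<in> U \<and> (\<forall>y\<in>U. \<forall>l\<ge>N. c l y = 0)"
    and S: "\<And>z N. z \<in> \<Omega> \<Longrightarrow> \<forall>l\<ge>N. c l z = 0 \<Longrightarrow> S z = (\<Sum>l<N. c l z *\<^sub>R W l)"
  shows "Ck k \<Omega> S"
proof (rule Ck_local)
  fix z assume "z \<in> \<Omega>"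
  then obtain N U where U: "open U" "z \<in> U" "\<forall>y\<in>U. \<forall>l\<ge>N. c l y = 0" using assms(3) by blast
  then have op: "open (\<Omega> \<inter> U)" using assms(1) by blast
  have "Ck k (\<Omega> \<inter> U) (\<lambda>z. c l z *\<^sub>R W l)" for l
    by (rule bounded_bilinear.Ck_prod[OF bounded_bilinear_scaleR op Ck_subset[OF assms(2)] Ck_const[OF op]])
      simp
  then have "Ck k (\<Omega> \<inter> U) (\<lambda>z. \<Sum>l<N. c l z *\<^sub>R W l)"
    by (rule Ck_sum[OF op])
  then have "Ck k (\<Omega> \<inter> U) S"
    by (rule Ck_cong[OF op, rotated]) (use S U(3) in auto)
  then show "\<exists>V. open V \<and> z \<in> V \<and> Ck k V S" using op \<open>z \<in> \<Omega>\<close> U(2) by blast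
qed

section \<open>Assembly of the vectors and the isometries\<close>

lemma Cr_empty: "Cr r {} f"
proof -
  have "Ck k {} f" for k
    by (induction k arbitrary: f) auto
  then show ?thesis by (simp add: Cr_def)
qed

lemma cblinop_weighted_sum:
  assumes "\<And>l. cblinop (W l)"
  shows "cblinop (\<Sum>l\<in>I. c l *\<^sub>R W l)"
  using assms unfolding cblinop_def
  by (simp add: blinfun.sum_left blinfun.scaleR_left linear_sum[OF bounded_linear.linear[OF bounded_linear_imul]]
      flip: imul_scaleR)

text \<open>The Hilbert space in (iv) is realised as a closed subspace of H, and operators on it are
  extended by 0 to the orthogonal complement. This preserves the operator norm, so
  \<open>Cr r \<Omega> S\<close> has the intended meaning.\<close>

theorem theorem1p3:
  fixes A :: "'h::chilbert \<Rightarrow>\<^sub>L 'h"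
    and \<Omega> :: "complex set" and r :: enat and d :: "complex \<Rightarrow> complex"
  assumes "separable_space (euclidean :: 'h topology)"
    and "infinite_dimensional TYPE('h)"
    and "cblinop A"
    and "open \<Omega>"
    and "Cr r \<Omega> d"
    and "d ` \<Omega> \<subseteq> interior (ess_numrange A)"
  shows "\<exists>u :: nat \<Rightarrow> complex \<Rightarrow> 'h.
     (\<forall>n. Cr r \<Omega> (u n)) \<and>
     (\<forall>n. \<forall>\<omega>\<in>\<Omega>. norm (u n \<omega>) = 1) \<and>
     (\<forall>n m. n \<noteq> m \<longrightarrow> (\<forall>\<omega>\<in>\<Omega>. \<forall>\<omega>'\<in>\<Omega>. cinner (u m \<omega>) (u n \<omega>') = 0)) \<and>
     (\<forall>n. \<forall>\<omega>\<in>\<Omega>. cinner (blinfun_apply A (u n \<omega>)) (u n \<omega>) = d \<omega>) \<and>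
     (\<exists>(X :: 'h set) (S :: complex \<Rightarrow> ('h \<Rightarrow>\<^sub>L 'h)).
        csubspace X \<and> closed X \<and> Cr r \<Omega> S \<and>
        (\<forall>\<omega>\<in>\<Omega>. cblinop (S \<omega>) \<and>
           (\<forall>x. (\<forall>y\<in>X. cinner x y = 0) \<longrightarrow> blinfun_apply (S \<omega>) x = 0) \<and>
           (\<forall>x\<in>X. norm (blinfun_apply (S \<omega>) x) = norm x) \<and>
           (\<forall>x\<in>X. blinfun_apply (cadj (S \<omega>)) (blinfun_apply A (blinfun_apply (S \<omega>) x))
                    = d \<omega> *\<^sub>C x)))"
proof (cases "\<Omega> = {}")
  \<comment> \<open>For empty \<Omega> the interior may be empty too, leaving no points
    \<open>\<mu> l\<close> to start from.\<close>
  case True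
  then show ?thesis
    by (intro exI[of _ "\<lambda>_ _. 0"] conjI exI[of _ UNIV] exI[of _ "\<lambda>_. 0"])
      (auto simp: csubspace_def Cr_empty)
next
  case False
  define G where "G = interior (ess_numrange A)"
  have dG: "d ` \<Omega> \<subseteq> G" and "G \<noteq> {}" using assms(6) False by (auto simp: G_def)
  obtain c :: "nat \<Rightarrow> complex \<Rightarrow> real" and \<mu> where \<mu>: "\<forall>l. \<mu> l \<in> G"
    and loc_fin: "\<forall>x\<in>G. \<exists>N U. open U \<and> x \<in> U \<and> (\<forall>y\<in>U. \<forall>l\<ge>N. c l y = 0)"
    and conv: "\<forall>x\<in>G. \<exists>N. (\<forall>l\<ge>N. c l x = 0) \<and> (\<Sum>l<N. (c l x)\<^sup>2) = 1 \<and>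
      (\<Sum>l<N. of_real ((c l x)\<^sup>2) * \<mu> l) = x"
    and Ck_c: "\<forall>k \<Omega> d l. open \<Omega> \<longrightarrow> Ck k \<Omega> d \<longrightarrow> d ` \<Omega> \<subseteq> G \<longrightarrow> Ck k \<Omega> (\<lambda>z. c l (d z))"
    using smooth_convex_coefficients[OF open_interior \<open>G \<noteq> {}\<close>[unfolded G_def]]
    unfolding G_def[symmetric] by (elim exE conjE) (rule that)
  \<comment> \<open>One sequence is indexed by pairs (n, l), with values depending on
    \<open>l\<close> only, so that all \<open>g l n\<close> are mutually orthogonal, also for the
    form of \<open>A\<close>.\<close>
  obtain e where e: "orthonormal_seq e"
    and Ae: "\<And>i j. cinner (A (e i)) (e j) = (if i = j then \<mu> (snd (prod_decode i)) else 0)"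
    using diagonalizing_sequence[of "\<lambda>i. \<mu> (snd (prod_decode i))" A] \<mu> unfolding G_def by blast
  define g where "g = (\<lambda>l n. e (prod_encode (n, l)))"
  have g_inner: "cinner (g l n) (g l' n') = (if l = l' \<and> n = n' then 1 else 0)" for l n l' n'
    using e by (auto simp: orthonormal_seq_def g_def)
  have Ag: "cinner (A (g l n)) (g l' n') = (if l = l' \<and> n = n' then \<mu> l else 0)" for l n l' n'
    by (auto simp: Ae g_def)
  have g: "orthonormal_seq (g l)" for l
    by (simp add: orthonormal_seq_def g_inner)
  define f where "f = g 0"
  have f: "orthonormal_seq f" by (simp add: f_def g)
  \<comment> \<open>A cutoff chosen pointwise; by \<open>sum_N\<close> any other admissible cutoff
    gives the same sum. As the coefficients are real, exchanging the sequences turns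
    \<open>S\<close> into its adjoint \<open>S'\<close>.\<close>
  define N where "N = (\<lambda>x. SOME N. \<forall>l\<ge>N. c l x = 0)"
  define S where "S = (\<lambda>\<omega>. \<Sum>l<N (d \<omega>). c l (d \<omega>) *\<^sub>R ctransport f (g l))"
  define S' where "S' = (\<lambda>\<omega>. \<Sum>l<N (d \<omega>). c l (d \<omega>) *\<^sub>R ctransport (g l) f)"
  have sum_N: "(\<Sum>l<N x. c l x *\<^sub>R w l) = (\<Sum>l<M. c l x *\<^sub>R w l)"
    if "\<forall>l\<ge>M. c l x = 0" for x M and w :: "nat \<Rightarrow> 'h \<Rightarrow>\<^sub>L 'h"
  proof -
    have N: "\<forall>l\<ge>N x. c l x = 0" unfolding N_def using that by (rule someI)
    have "(\<Sum>l<K. c l x *\<^sub>R w l) = (\<Sum>l<max (N x) M. c l x *\<^sub>R w l)"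
      if "\<forall>l\<ge>K. c l x = 0" "K \<le> max (N x) M" for K
      using that by (intro sum.mono_neutral_left) auto
    from this[OF N] this[OF that] show ?thesis by simp
  qed
  have Cr_S: "Cr r \<Omega> S"
    unfolding Cr_def
  proof (intro allI impI)
    fix k assume "enat k \<le> r"
    then have Ck_d: "Ck k \<Omega> d" using assms(5) by (simp add: Cr_def)
    show "Ck k \<Omega> S"
    proof (rule Ck_locally_finite_sum[OF assms(4)])
      show "Ck k \<Omega> (\<lambda>z. c l (d z))" for l using Ck_c assms(4) Ck_d dG by blast
      show "\<exists>N U. open U \<and> z \<in> U \<and> (\<forall>y\<in>U. \<forall>l\<ge>N. c l (d y) = 0)" if z: "z \<in> \<Omega>" for z
      proof -
        have "d z \<in> G" using dG z by auto
        from bspec[OF loc_fin this] obtain M U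
          where U: "open U" "d z \<in> U" "\<forall>y\<in>U. \<forall>l\<ge>M. c l y = 0" by (elim exE conjE)
        show ?thesis
        proof (intro exI conjI)
          show "open (\<Omega> \<inter> d -` U)"
            by (rule continuous_open_preimage[OF Ck_imp_continuous_on[OF Ck_d] assms(4) U(1)])
          show "z \<in> \<Omega> \<inter> d -` U" using z U(2) by simp
          show "\<forall>y\<in>\<Omega> \<inter> d -` U. \<forall>l\<ge>M. c l (d y) = 0" using U(3) by simp
        qed
      qed
      show "S z = (\<Sum>l<M. c l (d z) *\<^sub>R ctransport f (g l))" if "\<forall>l\<ge>M. c l (d z) = 0" for z M
        unfolding S_def by (rule sum_N[OF that])
    qed
  qed
  have cblinop: "cblinop (S \<omega>)" "cblinop (S' \<omega>)" for \<omega>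
    unfolding S_def S'_def by (intro cblinop_weighted_sum cblinop_ctransport f g)+
  have inner_S: "inner (S \<omega> x) y = inner x (S' \<omega> y)" for \<omega> x y
    unfolding S_def S'_def
    by (simp add: blinfun.sum_left blinfun.scaleR_left inner_sum_left inner_sum_right inner_ctransport f g)
  have cinner_S: "cinner x (S \<omega> y) = cinner (S' \<omega> x) y" for \<omega> x y
    using inner_S[of \<omega> y x] inner_S[of \<omega> "imul y" x] cblinop(1)[of \<omega>]
    by (simp add: cinner_def cblinop_def inner_commute)
  have Wf: "ctransport f (g l) (f n) = g l n" for l n
    using ctransport_single[OF f g, of "f n" n 1 l] g_inner[of 0 n 0]
    by (simp add: f_def scaleC_def eq_commute)
  have S_f: "S \<omega> (f n) = (\<Sum>l<N (d \<omega>). c l (d \<omega>) *\<^sub>R g l n)" for \<omega> n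
    by (simp add: S_def blinfun.sum_left blinfun.scaleR_left Wf)
  have key: "S' \<omega> (S \<omega> (f n)) = f n" "S' \<omega> (A (S \<omega> (f n))) = d \<omega> *\<^sub>C f n" if "\<omega> \<in> \<Omega>" for \<omega> n
  proof -
    have "d \<omega> \<in> G" using dG \<open>\<omega> \<in> \<Omega>\<close> by auto
    from bspec[OF conv this] obtain M where M: "\<forall>l\<ge>M. c l (d \<omega>) = 0" "(\<Sum>l<M. (c l (d \<omega>))\<^sup>2) = 1"
      "(\<Sum>l<M. of_real ((c l (d \<omega>))\<^sup>2) * \<mu> l) = d \<omega>"
      by (elim exE conjE)
    have "S \<omega> (f n) = (\<Sum>l<M. c l (d \<omega>) *\<^sub>R ctransport f (g l)) (f n)"
      unfolding S_def sum_N[OF M(1)] ..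
    also have "\<dots> = (\<Sum>l<M. c l (d \<omega>) *\<^sub>R g l n)"
      by (simp add: blinfun.sum_left blinfun.scaleR_left Wf)
    finally have Sf: "S \<omega> (f n) = (\<Sum>l<M. c l (d \<omega>) *\<^sub>R g l n)" .
    \<comment> \<open>Off-diagonal terms vanish, so the double sum collapses to squares of
      coefficients. A general \<open>B\<close> covers both the identity and
      \<open>A\<close>.\<close>
    have S'B: "S' \<omega> (B (S \<omega> (f n))) = (\<Sum>l<M. (c l (d \<omega>))\<^sup>2 *\<^sub>R (z l *\<^sub>C f n))"
      if B: "\<And>l l' m. cinner (B (g l n)) (g l' m) = (if l = l' \<and> n = m then z l else 0)" for B :: "'h \<Rightarrow>\<^sub>L 'h" and z
    proof -
      have "ctransport (g l') f (B (g l n)) = (if l = l' then z l else 0) *\<^sub>C f n" for l l'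
        by (rule ctransport_single[OF g f]) (auto simp: B)
      then have *: "ctransport (g l') f (B (g l n)) = (if l = l' then z l *\<^sub>C f n else 0)" for l l'
        by (simp add: scaleC_def)
      show ?thesis
        unfolding S'_def sum_N[OF M(1)] Sf
        by (simp add: blinfun.sum_left blinfun.scaleR_left blinfun.sum_right blinfun.scaleR_right *
            if_distrib power2_eq_square cong: if_cong)
    qed
    have "S' \<omega> (id_blinfun (S \<omega> (f n))) = (\<Sum>l<M. (c l (d \<omega>))\<^sup>2 *\<^sub>R (1 *\<^sub>C f n))"
      by (rule S'B) (simp add: g_inner)
    also have "\<dots> = f n"
      using M(2) by (simp add: scaleC_def flip: scaleR_sum_left)
    finally show "S' \<omega> (S \<omega> (f n)) = f n" by simp
    have "S' \<omega> (A (S \<omega> (f n))) = (\<Sum>l<M. (c l (d \<omega>))\<^sup>2 *\<^sub>R (\<mu> l *\<^sub>C f n))"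
      by (rule S'B) (simp add: Ag)
    also have "\<dots> = (\<Sum>l<M. of_real ((c l (d \<omega>))\<^sup>2) * \<mu> l) *\<^sub>C f n"
      by (simp add: scaleC_def scaleR_add_right sum.distrib flip: scaleR_sum_left)
    finally show "S' \<omega> (A (S \<omega> (f n))) = d \<omega> *\<^sub>C f n" unfolding M(3) .
  qed
  \<comment> \<open>As the fixed space of the projection onto the closed span of the
    \<open>f n\<close>, \<open>X\<close> is visibly closed, and its members are their own
    \<open>ctransport\<close> images, as \<open>eigen_on_range_ctransport\<close> needs.\<close>
  define X where "X = {x. ctransport f f x = x}"
  have cadj: "cadj (S \<omega>) = S' \<omega>" for \<omega>
    by (rule cadj_eqI[OF cblinop(2) inner_S])
  have on_X: "S' \<omega> (S \<omega> x) = x" "S' \<omega> (A (S \<omega> x)) = d \<omega> *\<^sub>C x" if "x \<in> X" "\<omega> \<in> \<Omega>" for x \<omega>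
  proof -
    have x: "ctransport f f x = x" using that(1) by (simp add: X_def)
    have "(S' \<omega> o\<^sub>L S \<omega>) (ctransport f f x) = 1 *\<^sub>C ctransport f f x"
      using key(1)[OF that(2)] cblinop[of \<omega>]
      by (intro eigen_on_range_ctransport f) (simp_all add: cblinop_def scaleC_def)
    then show "S' \<omega> (S \<omega> x) = x" by (simp add: x scaleC_def)
    have "(S' \<omega> o\<^sub>L A o\<^sub>L S \<omega>) (ctransport f f x) = d \<omega> *\<^sub>C ctransport f f x"
      using key(2)[OF that(2)] cblinop[of \<omega>] assms(3)
      by (intro eigen_on_range_ctransport f) (simp_all add: cblinop_def)
    then show "S' \<omega> (A (S \<omega> x)) = d \<omega> *\<^sub>C x" by (simp add: x)
  qed
  have fX: "f n \<in> X" for n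
    using ctransport_single[OF f f, of "f n" n 1] g_inner[of 0 n 0]
    by (simp add: X_def f_def scaleC_def eq_commute)
  have norm_S: "norm (S \<omega> x) = norm x" if "x \<in> X" "\<omega> \<in> \<Omega>" for x \<omega>
    by (simp add: norm_eq_sqrt_inner inner_S on_X(1)[OF that])
  have norm_f: "norm (f n) = 1" for n
    using orthonormal_seq_inner(1)[OF f, of n n] by (simp add: norm_eq_sqrt_inner)
  have "csubspace X"
    using cblinop_ctransport[OF f f]
    by (auto simp: csubspace_def X_def scaleC_def cblinop_def blinfun.zero_right blinfun.add_right blinfun.scaleR_right)
  moreover have "closed X"
    unfolding X_def by (intro closed_Collect_eq) (auto intro: continuous_intros)
  moreover have "S \<omega> x = 0" if "\<forall>y\<in>X. cinner x y = 0" for x \<omega>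
  proof -
    \<comment> \<open>All coefficients are zero, so \<open>z = 0\<close> and the index 0 is
      arbitrary.\<close>
    have "ctransport f (g l) x = 0 *\<^sub>C g l 0" for l
      by (rule ctransport_single[OF f g]) (use that fX in auto)
    then show ?thesis by (simp add: S_def blinfun.sum_left blinfun.scaleR_left scaleC_def)
  qed
  ultimately have iv: "csubspace X \<and> closed X \<and> Cr r \<Omega> S \<and>
      (\<forall>\<omega>\<in>\<Omega>. cblinop (S \<omega>) \<and>
         (\<forall>x. (\<forall>y\<in>X. cinner x y = 0) \<longrightarrow> S \<omega> x = 0) \<and>
         (\<forall>x\<in>X. norm (S \<omega> x) = norm x) \<and>
         (\<forall>x\<in>X. cadj (S \<omega>) (A (S \<omega> x)) = d \<omega> *\<^sub>C x))"
    using Cr_S cblinop norm_S on_X(2) cadj by simp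
  have "Cr r \<Omega> (\<lambda>\<omega>. S \<omega> (f n))" for n
    using Cr_S bounded_linear.Ck_compose[OF blinfun.bounded_linear_left assms(4)] unfolding Cr_def by blast
  \<comment> \<open>The parameters may differ because \<open>g l n\<close> and \<open>g l' m\<close>
    are orthogonal for n \<noteq> m, whatever l and l' are.\<close>
  moreover have "cinner (S \<omega> (f m)) (S \<omega>' (f n)) = 0" if "n \<noteq> m" for n m \<omega> \<omega>'
    using that by (simp add: S_f cinner.sum_left cinner.sum_right cinner.scaleR_left cinner.scaleR_right g_inner)
  moreover have "cinner (A (S \<omega> (f n))) (S \<omega> (f n)) = d \<omega>" if "\<omega> \<in> \<Omega>" for n \<omega>
    by (simp add: cinner_S key(2)[OF that] cinner_scaleC_left cinner_self norm_f)
  ultimately show ?thesis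
    using norm_S[OF fX] norm_f iv
    by (intro exI[of _ "\<lambda>n \<omega>. S \<omega> (f n)"] conjI exI[of _ X] exI[of _ S]) auto
qed

end
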